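(* Let $\mathbf{V}=(V_n)$ be a good ssee and let $k\in\mathbb{N}$. Suppose that: (a) for every hereditary property $\mathcal{P}$ of $k$-colourings of $\mathbf{V}$ with $\mathcal{P}_n\neq\emptyset$ for all $n$, the sequence $\mathrm{ex}(V_n,\mathcal{P}_n)/|V_n|$ is nonincreasing in $n$ (so it tends to a limit $\pi(\mathcal{P})$); (b) for every $N$ and every nonempty family $\mathcal{F}$ of $k$-colourings of $V_N$ such that $\mathcal{P}=\mathrm{Forb}_{\mathbf{V}}(\mathcal{F})$ has $\mathcal{P}_n\ne\emptyset$ for all $n$: for every $\varepsilon>0$ there exist $\delta>0$ and $n_0\in\mathbb{N}$ such that for $n\ge n_0$, every template $t$ of $V_n$ with at most $\delta\bigl|\binom{V_n}{V_N}\bigr|$ pairs $(\phi,c)$ with $\phi\in\binom{V_n}{V_N}$, $c\in\mathcal{F}$, $c\in\langle t_{|\phi}\rangle$ satisfies $\mathrm{Ent}(t)\le(\pi(\mathcal{P})+\varepsilon)|V_n|$. Then for every hereditary property $\mathcal{P}$ of $k$-colourings of $\mathbf{V}$ with $\mathcal{P}_n\neq\emptyset$ for all $n$, $|\mathcal{P}_n|=k^{(\pi(\mathcal{P})+o(1))|V_n|}$.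
   Context: A ssee is a sequence $\mathbf{V}=(V_n)$ of finite sets with, for every $N\le n$, a collection $\binom{V_n}{V_N}$ of injections $V_N\to V_n$. A $k$-colouring of a set $V$ is a map $V\to[k]$; a template is $t:V\to2^{[k]}\setminus\{\emptyset\}$, $\langle t\rangle$ is the set of colourings $c$ with $c(x)\in t(x)$ for all $x$, and $\mathrm{Ent}(t)=\sum_{x\in V}\log_k|t(x)|$. For $\phi\in\binom{V_n}{V_N}$, $t_{|\phi}(x)=t(\phi(x))$, $c_{|\phi}(x)=c(\phi(x))$. A $k$-colouring property of $\mathbf{V}$ is a sequence $(\mathcal{P}_n)$ with $\mathcal{P}_n$ a set of $k$-colourings of $V_n$; it is hereditary if $c_{|\phi}\in\mathcal{P}_N$ whenever $c\in\mathcal{P}_n$, $\phi\in\binom{V_n}{V_N}$. $\mathrm{ex}(V_n,\mathcal{P}_n)=\max\{\mathrm{Ent}(t):t \text{ template of } V_n,\ \langle t\rangle\subseteq\mathcal{P}_n\}$. $\mathrm{Forb}_{\mathbf{V}}(\mathcal{F})_n$ is the set of colourings $c$ of $V_n$ with $c_{|\phi}\notin\mathcal{F}$ for all $\phi\in\binom{V_n}{V_N}$. Goodness: let $I(N,n)=\sum_{1<i<|V_N|}I_i$, where $I_i$ is the number of maps from the disjoint union of two copies of $V_N$ into $V_n$ whose restriction to each copy is in $\binom{V_n}{V_N}$ and whose two images meet in exactly $i$ elements; $\mathbf{V}$ is good if $|V_n|\to\infty$ and, for all $N$ with $|V_N|>1$, $\bigl|\binom{V_n}{V_N}\bigr|/|V_n|\to\infty$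 and $|V_n|I(N,n)/\bigl|\binom{V_n}{V_N}\bigr|^2\to0$ as $n\to\infty$.
   Formalization: It is additionally assumed that each property Forb(F) occurring in (b) is hereditary (automatic when embeddings compose), since π is defined only for hereditary properties and the claim fails otherwise; monotonicity in (a) is required only at indices with V_n nonempty. *)

theory Defs
  imports "HOL-Analysis.Analysis"
begin

text \<open>
  A ssee is given by its sets \<open>V n\<close> and, for \<open>N \<le> n\<close>, the collection \<open>E N n\<close> of embeddings of
  \<open>V N\<close> into \<open>V n\<close>; the values \<open>E N n\<close> with \<open>n < N\<close> carry no meaning. Embeddings, colourings and
  templates are extensional functions, so that they can be counted, and the restriction of
  a colouring or template \<open>f\<close> of \<open>V n\<close> along \<open>\<phi> \<in> E N n\<close> is \<open>compose (V N) f \<phi>\<close>.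
\<close>

definition ssee :: "(nat \<Rightarrow> 'a set) \<Rightarrow> (nat \<Rightarrow> nat \<Rightarrow> ('a \<Rightarrow> 'a) set) \<Rightarrow> bool" where
  "ssee V E \<longleftrightarrow> (\<forall>n. finite (V n)) \<and>
     (\<forall>N n. N \<le> n \<longrightarrow> (\<forall>\<phi> \<in> E N n. \<phi> \<in> V N \<rightarrow>\<^sub>E V n \<and> inj_on \<phi> (V N)))"

definition intersecting_maps ::
    "(nat \<Rightarrow> 'a set) \<Rightarrow> (nat \<Rightarrow> nat \<Rightarrow> ('a \<Rightarrow> 'a) set) \<Rightarrow> nat \<Rightarrow> nat \<Rightarrow> nat \<Rightarrow> ('a + 'a \<Rightarrow> 'a) set" where
  "intersecting_maps V E N n i =
     {f \<in> (V N <+> V N) \<rightarrow>\<^sub>E V n.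
        compose (V N) f Inl \<in> E N n \<and> compose (V N) f Inr \<in> E N n \<and>
        card (f ` Inl ` V N \<inter> f ` Inr ` V N) = i}"

definition intersection_count ::
    "(nat \<Rightarrow> 'a set) \<Rightarrow> (nat \<Rightarrow> nat \<Rightarrow> ('a \<Rightarrow> 'a) set) \<Rightarrow> nat \<Rightarrow> nat \<Rightarrow> nat" where
  "intersection_count V E N n = (\<Sum>i \<in> {1<..<card (V N)}. card (intersecting_maps V E N n i))"

definition good_ssee :: "(nat \<Rightarrow> 'a set) \<Rightarrow> (nat \<Rightarrow> nat \<Rightarrow> ('a \<Rightarrow> 'a) set) \<Rightarrow> bool" where
  "good_ssee V E \<longleftrightarrow> ssee V E \<and>
     filterlim (\<lambda>n. real (card (V n))) at_top sequentially \<and>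
     (\<forall>N. card (V N) > 1 \<longrightarrow>
        filterlim (\<lambda>n. real (card (E N n)) / real (card (V n))) at_top sequentially \<and>
        (\<lambda>n. real (card (V n)) * real (intersection_count V E N n) / (real (card (E N n)))\<^sup>2)
          \<longlonglongrightarrow> 0)"

definition colourings :: "nat \<Rightarrow> 'a set \<Rightarrow> ('a \<Rightarrow> nat) set" where
  "colourings k A = A \<rightarrow>\<^sub>E {1..k}"

definition templates :: "nat \<Rightarrow> 'a set \<Rightarrow> ('a \<Rightarrow> nat set) set" where
  "templates k A = A \<rightarrow>\<^sub>E (Pow {1..k} - {{}})"

definition realisations :: "'a set \<Rightarrow> ('a \<Rightarrow> nat set) \<Rightarrow> ('a \<Rightarrow> nat) set" where
  "realisations A t = Pi\<^sub>E A t"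

definition Ent :: "nat \<Rightarrow> 'a set \<Rightarrow> ('a \<Rightarrow> nat set) \<Rightarrow> real" where
  "Ent k A t = (\<Sum>x\<in>A. log (real k) (real (card (t x))))"

definition hereditary_property ::
    "(nat \<Rightarrow> 'a set) \<Rightarrow> (nat \<Rightarrow> nat \<Rightarrow> ('a \<Rightarrow> 'a) set) \<Rightarrow> nat \<Rightarrow> (nat \<Rightarrow> ('a \<Rightarrow> nat) set) \<Rightarrow> bool" where
  "hereditary_property V E k P \<longleftrightarrow>
     (\<forall>n. P n \<subseteq> colourings k (V n)) \<and>
     (\<forall>N n. N \<le> n \<longrightarrow> (\<forall>c \<in> P n. \<forall>\<phi> \<in> E N n. compose (V N) c \<phi> \<in> P N))"

definition ex_ent :: "nat \<Rightarrow> 'a set \<Rightarrow> ('a \<Rightarrow> nat) set \<Rightarrow> real" where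
  "ex_ent k A Q = Max {Ent k A t | t. t \<in> templates k A \<and> realisations A t \<subseteq> Q}"

definition entropy_density :: "(nat \<Rightarrow> 'a set) \<Rightarrow> nat \<Rightarrow> (nat \<Rightarrow> ('a \<Rightarrow> nat) set) \<Rightarrow> real" where
  "entropy_density V k P = lim (\<lambda>n. ex_ent k (V n) (P n) / real (card (V n)))"

definition Forb ::
    "(nat \<Rightarrow> 'a set) \<Rightarrow> (nat \<Rightarrow> nat \<Rightarrow> ('a \<Rightarrow> 'a) set) \<Rightarrow> nat \<Rightarrow> nat \<Rightarrow> ('a \<Rightarrow> nat) set
      \<Rightarrow> nat \<Rightarrow> ('a \<Rightarrow> nat) set" where
  "Forb V E k N F n =
     {c \<in> colourings k (V n). N \<le> n \<longrightarrow> (\<forall>\<phi> \<in> E N n. compose (V N) c \<phi> \<notin> F)}"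

text \<open>
  The density of a forbidden-colourings property makes sense as the limit of a monotone sequence
  only if that property is hereditary. This is automatic when embeddings compose:
\<close>

lemma Forb_hereditary_if_compose:
  assumes S: "ssee V E"
    and C: "\<And>N m n \<phi> \<psi>. N \<le> m \<Longrightarrow> m \<le> n \<Longrightarrow> \<phi> \<in> E N m \<Longrightarrow> \<psi> \<in> E m n \<Longrightarrow>
              compose (V N) \<psi> \<phi> \<in> E N n"
  shows "hereditary_property V E k (Forb V E k N F)"
  unfolding hereditary_property_def
proof (intro conjI allI impI ballI)
  show "Forb V E k N F n \<subseteq> colourings k (V n)" for n
    by (auto simp: Forb_def)
next
  fix m n c \<psi>
  assume mn: "m \<le> n" and c: "c \<in> Forb V E k N F n" and psi: "\<psi> \<in> E m n"
  have psiV: "\<psi> \<in> V m \<rightarrow>\<^sub>E V n" using S mn psi by (auto simp: ssee_def)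
  have "compose (V m) c \<psi> \<in> colourings k (V m)"
    using c psiV by (auto simp: Forb_def colourings_def compose_def)
  moreover have "compose (V N) (compose (V m) c \<psi>) \<phi> \<notin> F"
    if Nm: "N \<le> m" and phi: "\<phi> \<in> E N m" for \<phi>
  proof -
    have phiV: "\<phi> \<in> V N \<rightarrow> V m" using S Nm phi unfolding ssee_def by (blast dest: PiE_mem)
    have "compose (V N) (compose (V m) c \<psi>) \<phi> = compose (V N) c (compose (V N) \<psi> \<phi>)"
      using phiV by (intro ext) (auto simp: compose_def restrict_def)
    moreover have "compose (V N) \<psi> \<phi> \<in> E N n" using C[OF Nm mn phi psi] .
    ultimately show ?thesis using c Nm mn by (auto simp: Forb_def)
  qed
  ultimately show "compose (V m) c \<psi> \<in> Forb V E k N F m"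
    by (auto simp: Forb_def)
qed

end

theory Submission
  imports Defs
begin

text \<open>
  The lower bound is immediate, since the realisations of an extremal template all lie in
  \<open>P n\<close>. For the upper bound let \<open>N\<close> be large and let \<open>F\<close> be the complement of \<open>P N\<close>. For each
  \<open>f \<in> F\<close> a colouring \<open>c\<close> in \<open>Forb V E k N F n\<close> gives sets \<open>A x = {u. c u = f x}\<close> that no
  embedding respects, i.e. an independent set of a \<open>V N\<close>-partite hypergraph with edge set
  \<open>E N n\<close>. Goodness says that codegrees are negligible compared with the average degree, and a
  container theorem in this regime provides \<open>k\<close> to the \<open>o(card (V n))\<close> templates, each with few
  bad pairs, that cover \<open>Forb V E k N F n\<close>. By supersaturation each of them has small entropy.

  The container theorem is proved by induction on the number of positions. A maximal small
  fingerprint \<open>S \<subseteq> A z\<close> selects edges through \<open>S\<close> of controlled degree; forgetting \<open>z\<close> they form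
  a hypergraph \<open>G\<close> of lower uniformity in which \<open>A\<close> is still independent. If \<open>G\<close> has many edges,
  the containers of \<open>G\<close> discard a constant proportion of the vertices, independently of the size
  of \<open>S\<close>, which can only happen boundedly often. If \<open>G\<close> has few edges, few vertices are
  saturated, and by maximality of \<open>S\<close> the vertices of \<open>A z\<close> lie in few edges.
\<close>

section \<open>Containers for hypergraphs of bounded degree and small codegree\<close>

text \<open>Exponential Markov inequality: give \<open>S\<close> the weight x^|S| with x < 1. A set
  of size at most \<open>\<sigma> * M\<close> then has weight at least x^(\<sigma> M), while all
  subsets together weigh (1 + x)^|U|. It serves to count fingerprints.\<close>

lemma card_small_subsets:
  fixes \<epsilon> :: real
  assumes "\<epsilon> > 0"
  obtains \<sigma> :: real where "\<sigma> > 0"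
    "\<And>(U::'u set) M. finite U \<Longrightarrow> real (card U) \<le> M \<Longrightarrow>
       real (card {S. S \<subseteq> U \<and> real (card S) \<le> \<sigma> * M}) \<le> 2 powr (\<epsilon> * M)"
proof -
  \<comment> \<open>The cap 1/2 keeps log 2 (1/x) positive. The other bound lets (1 + x)^M use half
    of the exponent \<epsilon> M; \<open>\<sigma>\<close> is then chosen so that x powr (-\<sigma>
    M) uses exactly the other half.\<close>
  define x :: real where "x = min (1/2) (2 powr (\<epsilon>/2) - 1)"
  have x: "0 < x" "x < 1" "1 + x \<le> 2 powr (\<epsilon>/2)"
    using assms by (auto simp: x_def)
  define \<sigma> where "\<sigma> = (\<epsilon>/2) / log 2 (1/x)"
  have lx: "log 2 (1/x) > 0" using x by simp
  have "\<sigma> > 0" using assms lx by (simp add: \<sigma>_def)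
  moreover have "real (card {S. S \<subseteq> U \<and> real (card S) \<le> \<sigma> * M}) \<le> 2 powr (\<epsilon> * M)"
    if U: "finite U" "real (card U) \<le> M" for U :: "'u set" and M
  proof -
    let ?T = "{S. S \<subseteq> U \<and> real (card S) \<le> \<sigma> * M}"
    have fT: "finite ?T" using U by simp
    have one: "1 \<le> x powr (- \<sigma> * M) * x ^ card S" if "S \<in> ?T" for S
    proof -
      have "x powr (- \<sigma> * M) * x ^ card S = x powr (real (card S) - \<sigma> * M)"
        using x by (simp add: powr_realpow[symmetric] powr_add[symmetric])
      moreover have "1 \<le> x powr (real (card S) - \<sigma> * M)"
        using x that powr_mono'[of "real (card S) - \<sigma> * M" 0 x] by simp
      ultimately show ?thesis by simp
    qed
    have gen: "(\<Sum>S\<in>Pow U. x ^ card S) = (1 + x) ^ card U"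
    proof -
      have "(\<Prod>u\<in>U. x + 1) = (\<Sum>S\<in>Pow U. (\<Prod>u\<in>S. x) * (\<Prod>u\<in>U - S. 1))"
        by (rule prod_add[OF U(1)])
      then show ?thesis by (simp add: add.commute)
    qed
    have "x powr (- \<sigma>) = 2 powr (\<epsilon>/2)"
    proof -
      have "x = 2 powr (- log 2 (1/x))"
        using x by (simp add: powr_minus log_inverse[symmetric] field_simps)
      then have "x powr (- \<sigma>) = 2 powr (log 2 (1/x) * \<sigma>)"
        by (metis minus_mult_minus powr_powr)
      then show ?thesis using lx by (simp add: \<sigma>_def)
    qed
    then have px: "x powr (- \<sigma> * M) = 2 powr (\<epsilon>/2 * M)"
      by (metis powr_powr)
    have "real (card ?T) = (\<Sum>S\<in>?T. 1)" by simp
    also have "\<dots> \<le> (\<Sum>S\<in>?T. x powr (- \<sigma> * M) * x ^ card S)"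
      using one by (intro sum_mono) auto
    also have "\<dots> \<le> (\<Sum>S\<in>Pow U. x powr (- \<sigma> * M) * x ^ card S)"
      using U x by (intro sum_mono2) auto
    also have "\<dots> = x powr (- \<sigma> * M) * (1 + x) ^ card U"
      by (simp add: sum_distrib_left[symmetric] gen)
    also have "\<dots> \<le> x powr (- \<sigma> * M) * (1 + x) powr M"
      using x U by (intro mult_left_mono) (auto simp: powr_realpow[symmetric])
    also have "\<dots> \<le> 2 powr (\<epsilon>/2 * M) * (2 powr (\<epsilon>/2)) powr M"
      unfolding px using x U by (intro mult_left_mono powr_mono2) auto
    also have "\<dots> = 2 powr (\<epsilon> * M)"
      by (simp add: powr_powr powr_add[symmetric] field_simps)
    finally show ?thesis .
  qed
  ultimately show ?thesis using that by blast
qed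

lemma card_fibres:
  assumes "finite E" "finite X"
  shows "card {e \<in> E. f e \<in> X} = (\<Sum>u\<in>X. card {e \<in> E. f e = u})"
proof -
  have "{e \<in> E. f e \<in> X} = (\<Union>u\<in>X. {e \<in> E. f e = u})" by auto
  then show ?thesis
    using assms by (simp, subst card_UN_disjoint) auto
qed

lemma card_le_weight:
  fixes \<mu> :: "'u \<Rightarrow> real"
  assumes "finite E" "finite X" "\<And>u. u \<in> X \<Longrightarrow> real (card {e \<in> E. f e = u}) \<le> a * \<mu> u"
  shows "real (card {e \<in> E. f e \<in> X}) \<le> a * sum \<mu> X"
  using assms by (simp add: card_fibres sum_distrib_left sum_mono)

lemma weight_le_card:
  fixes \<mu> :: "'u \<Rightarrow> real"
  assumes "finite E" "finite X" "\<And>u. u \<in> X \<Longrightarrow> a * \<mu> u \<le> real (card {e \<in> E. f e = u})"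
  shows "a * sum \<mu> X \<le> real (card E)"
proof -
  have "a * sum \<mu> X \<le> real (card {e \<in> E. f e \<in> X})"
    using assms by (simp add: card_fibres sum_distrib_left sum_mono)
  also have "\<dots> \<le> real (card E)"
    using assms by (simp add: card_mono)
  finally show ?thesis .
qed

section \<open>Weighted multipartite hypergraphs and the fingerprint round\<close>

definition edges_in :: "'j set \<Rightarrow> ('j \<Rightarrow> 'u) set \<Rightarrow> ('j \<Rightarrow> 'u set) \<Rightarrow> ('j \<Rightarrow> 'u) set" where
  "edges_in J E C = {e \<in> E. \<forall>j\<in>J. e j \<in> C j}"

text \<open>
  Edges are functions on a set containing \<open>J\<close>, so that passing to a smaller set of positions
  leaves the edges, and hence their multiplicities, unchanged. The weight \<open>\<mu>\<close> absorbs irregular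
  degrees: it is allowed to be large, at the price of a larger total weight.
\<close>

definition bounded_hypergraph ::
    "'j set \<Rightarrow> 'u set \<Rightarrow> ('u \<Rightarrow> real) \<Rightarrow> real \<Rightarrow> real \<Rightarrow> ('j \<Rightarrow> 'u) set \<Rightarrow> bool" where
  "bounded_hypergraph J U \<mu> D \<kappa> E \<longleftrightarrow>
     finite E \<and> (\<forall>e\<in>E. \<forall>j\<in>J. e j \<in> U) \<and>
     (\<forall>j\<in>J. \<forall>u\<in>U. real (card {e\<in>E. e j = u}) \<le> D * \<mu> u) \<and>
     (\<forall>i\<in>J. \<forall>j\<in>J. i \<noteq> j \<longrightarrow> (\<forall>u v. real (card {e\<in>E. e i = u \<and> e j = v}) \<le> \<kappa> * D))"

text \<open>Independent families and containers have a separate vertex set for each position. Only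
  the independent families are confined to \<open>B\<close>; where containment matters, the
  containers are intersected with the ambient sets afterwards.\<close>

definition has_containers ::
    "'j set \<Rightarrow> ('j \<Rightarrow> 'u set) \<Rightarrow> ('j \<Rightarrow> 'u) set \<Rightarrow> real \<Rightarrow> real \<Rightarrow> bool" where
  "has_containers J B E K m \<longleftrightarrow>
     (\<exists>\<C>. finite \<C> \<and> real (card \<C>) \<le> K \<and> (\<forall>C\<in>\<C>. real (card (edges_in J E C)) \<le> m) \<and>
       (\<forall>A. (\<forall>j\<in>J. A j \<subseteq> B j) \<longrightarrow> edges_in J E A = {} \<longrightarrow> (\<exists>C\<in>\<C>. \<forall>j\<in>J. A j \<subseteq> C j)))"

text \<open>
  One round: a small fingerprint \<open>S\<close> of \<open>A z\<close> yields a hypergraph of lower uniformity in which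
  \<open>A\<close> is still independent. Choosing \<open>S\<close> maximal, instead of growing it greedily, makes the chosen
  hypergraph a function of the set \<open>S\<close> alone.
\<close>

lemma container_round:
  fixes \<mu> :: "'u \<Rightarrow> real" and C0 :: "'j \<Rightarrow> 'u set"
  assumes J: "finite J" "J \<noteq> {}" "z \<notin> J"
    and U: "finite U" and \<mu>: "\<And>u. u \<in> U \<Longrightarrow> \<mu> u \<ge> 1"
    and H: "bounded_hypergraph (insert z J) U \<mu> D \<kappa> E" and D: "D > 0"
    and C0: "\<And>j. j \<in> insert z J \<Longrightarrow> C0 j \<subseteq> U"
    and E0: "\<And>e j. e \<in> E \<Longrightarrow> j \<in> insert z J \<Longrightarrow> e j \<in> C0 j"
    and pos: "\<eta> > 0" "\<tau> > 0" "\<delta> > 0"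
    and \<kappa>: "\<kappa> \<le> \<tau>" "\<kappa> \<le> 2 * \<tau> * \<kappa>'"
    and lower: "\<And>G. bounded_hypergraph J U \<mu> (2 * \<tau> * D) \<kappa>' G \<Longrightarrow>
        has_containers J (\<lambda>_. U) G K (\<delta> * (2 * \<tau> * D) * sum \<mu> U)"
    and small: "real (card {S. S \<subseteq> U \<and> real (card S) \<le> 2 * \<tau> / \<eta> * sum \<mu> U}) \<le> L"
    and K: "K \<ge> 0"
  shows "\<exists>\<C>. finite \<C> \<and> real (card \<C>) \<le> L * K \<and>
     (\<forall>C\<in>\<C>. (\<forall>j\<in>insert z J. C j \<subseteq> C0 j) \<and>
        (real (card (edges_in (insert z J) E C))
            \<le> (2 * \<tau> / \<eta> + \<eta> + 4 * real (card J) * \<delta>) * D * sum \<mu> U \<or>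
         \<delta> * sum \<mu> U \<le> (\<Sum>j\<in>J. sum \<mu> (C0 j - C j)))) \<and>
     (\<forall>A. (\<forall>j\<in>insert z J. A j \<subseteq> C0 j) \<longrightarrow> edges_in (insert z J) E A = {} \<longrightarrow>
        (\<exists>C\<in>\<C>. \<forall>j\<in>insert z J. A j \<subseteq> C j))"
proof -
  define M where "M = sum \<mu> U"
  have fE: "finite E" using H by (simp add: bounded_hypergraph_def)
  have EU: "e j \<in> U" if "e \<in> E" "j \<in> insert z J" for e j
    using E0[OF that] C0[OF that(2)] by blast
  have deg: "real (card {e\<in>E. e j = u}) \<le> D * \<mu> u" if "j \<in> insert z J" "u \<in> U" for j u
    using H that unfolding bounded_hypergraph_def by blast
  have codeg: "real (card {e\<in>E. e i = u \<and> e j = v}) \<le> \<kappa> * D"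
    if "i \<in> insert z J" "j \<in> insert z J" "i \<noteq> j" for i j u v
    using H that unfolding bounded_hypergraph_def by blast
  have \<mu>0: "\<mu> u \<ge> 0" if "u \<in> U" for u using \<mu>[OF that] by simp
  have wt_mono: "sum \<mu> X \<le> sum \<mu> Y" if "X \<subseteq> Y" "Y \<subseteq> U" for X Y
    using that U \<mu>0 by (intro sum_mono2) (auto intro: finite_subset)

  \<comment> \<open>\<open>G\<close> consists of the edges charged to \<open>S\<close>. The degree
    cap, twice the saturation level \<tau> D \<mu>, makes \<open>G\<close> fit the bound assumed in
    \<open>lower\<close>; the lower bound on |G| is what keeps \<open>S\<close> small.\<close>
  define valid where "valid S G \<longleftrightarrow> S \<subseteq> U \<and> G \<subseteq> E \<and> (\<forall>e\<in>G. e z \<in> S) \<and>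
    (\<forall>j\<in>J. \<forall>u\<in>U. real (card {e\<in>G. e j = u}) \<le> 2 * \<tau> * D * \<mu> u) \<and>
    \<eta> * D * sum \<mu> S \<le> real (card G)" for S G
  define g where "g S = (SOME G. valid S G)" for S
  define \<S> where "\<S> = {S. \<exists>G. valid S G}"
  have g: "valid S (g S)" if "S \<in> \<S>" for S
    using that unfolding \<S>_def g_def by (auto intro: someI_ex)
  have fg: "finite (g S)" if "S \<in> \<S>" for S
    using g[OF that] fE unfolding valid_def by (auto intro: finite_subset)
  \<comment> \<open>Double counting of \<open>g S\<close> at one position \<open>j0\<close>: its
    guaranteed size against the degree cap summed over \<open>U\<close>.\<close>
  have wtS: "sum \<mu> S \<le> 2 * \<tau> / \<eta> * M" if "S \<in> \<S>" for S
  proof -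
    obtain j0 where j0: "j0 \<in> J" using J by blast
    have gs: "g S \<subseteq> E" using g[OF that] by (simp add: valid_def)
    have "real (card {e\<in>g S. e j0 \<in> U}) \<le> 2 * \<tau> * D * sum \<mu> U"
      using g[OF that] j0 by (intro card_le_weight fg that U) (auto simp: valid_def)
    moreover have "{e\<in>g S. e j0 \<in> U} = g S" using gs EU j0 by auto
    ultimately have "\<eta> * D * sum \<mu> S \<le> 2 * \<tau> * D * M"
      using g[OF that] by (simp add: valid_def M_def)
    then have "D * (\<eta> * sum \<mu> S) \<le> D * (2 * \<tau> * M)" by (simp add: ac_simps)
    then have "\<eta> * sum \<mu> S \<le> 2 * \<tau> * M" using D by simp
    then show ?thesis using pos by (simp add: field_simps)
  qed
  have \<S>_small: "\<S> \<subseteq> {S. S \<subseteq> U \<and> real (card S) \<le> 2 * \<tau> / \<eta> * sum \<mu> U}"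
  proof safe
    fix S assume S: "S \<in> \<S>"
    have SU: "S \<subseteq> U" using g[OF S] by (simp add: valid_def)
    then show "x \<in> U" if "x \<in> S" for x using that by blast
    have "real (card S) = (\<Sum>u\<in>S. 1)" by simp
    also have "\<dots> \<le> sum \<mu> S" using SU \<mu> by (intro sum_mono) auto
    also have "\<dots> \<le> 2 * \<tau> / \<eta> * M" by (rule wtS[OF S])
    finally show "real (card S) \<le> 2 * \<tau> / \<eta> * sum \<mu> U" by (simp add: M_def)
  qed
  have f\<S>: "finite \<S>" using \<S>_small by (rule finite_subset) (use U in simp)
  have card\<S>: "real (card \<S>) \<le> L"
    using card_mono[OF _ \<S>_small] U small by simp

  \<comment> \<open>Absolute codegrees do not grow in a subset, but the degree scale falls from
    \<open>D\<close> to 2 \<tau> D; the bound \<kappa> \<le> 2 \<tau> \<kappa>' pays for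
    this.\<close>
  have bounded_g: "bounded_hypergraph J U \<mu> (2 * \<tau> * D) \<kappa>' (g S)" if S: "S \<in> \<S>" for S
    unfolding bounded_hypergraph_def
  proof (intro conjI ballI allI impI)
    have gs: "g S \<subseteq> E" using g[OF S] by (simp add: valid_def)
    show "finite (g S)" by (rule fg[OF S])
    show "e j \<in> U" if "e \<in> g S" "j \<in> J" for e j using that gs EU by blast
    show "real (card {e\<in>g S. e j = u}) \<le> 2 * \<tau> * D * \<mu> u" if "j \<in> J" "u \<in> U" for j u
      using g[OF S] that by (simp add: valid_def)
    show "real (card {e\<in>g S. e i = u \<and> e j = v}) \<le> \<kappa>' * (2 * \<tau> * D)"
      if "i \<in> J" "j \<in> J" "i \<noteq> j" for i j u v
    proof -
      have "card {e\<in>g S. e i = u \<and> e j = v} \<le> card {e\<in>E. e i = u \<and> e j = v}"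
        using fE gs by (intro card_mono) auto
      also have "real \<dots> \<le> \<kappa> * D" using codeg that by blast
      also have "\<dots> \<le> 2 * \<tau> * \<kappa>' * D" using \<kappa> D by (intro mult_right_mono) auto
      finally show ?thesis by (simp add: ac_simps)
    qed
  qed
  have "\<forall>S\<in>\<S>. \<exists>\<C>. finite \<C> \<and> real (card \<C>) \<le> K \<and>
      (\<forall>C\<in>\<C>. real (card (edges_in J (g S) C)) \<le> \<delta> * (2 * \<tau> * D) * M) \<and>
      (\<forall>A. (\<forall>j\<in>J. A j \<subseteq> U) \<longrightarrow> edges_in J (g S) A = {} \<longrightarrow> (\<exists>C\<in>\<C>. \<forall>j\<in>J. A j \<subseteq> C j))"
    using lower[OF bounded_g] unfolding has_containers_def M_def by blast
  then obtain \<D> where \<D>: "\<And>S. S \<in> \<S> \<Longrightarrow> finite (\<D> S)" "\<And>S. S \<in> \<S> \<Longrightarrow> real (card (\<D> S)) \<le> K"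
    "\<And>S C. S \<in> \<S> \<Longrightarrow> C \<in> \<D> S \<Longrightarrow> real (card (edges_in J (g S) C)) \<le> \<delta> * (2 * \<tau> * D) * M"
    "\<And>S A. S \<in> \<S> \<Longrightarrow> (\<forall>j\<in>J. A j \<subseteq> U) \<Longrightarrow> edges_in J (g S) A = {} \<Longrightarrow>
        \<exists>C\<in>\<D> S. \<forall>j\<in>J. A j \<subseteq> C j"
    using bchoice[of \<S>] by metis

  \<comment> \<open>An edge is unsaturated if each of its vertices off \<open>z\<close> is below
    half the degree cap. The vertices in \<open>low S\<close> have too few such edges to be sure of
    supplying the share \<eta> D \<mu> v expected of a new member of \<open>S\<close>.\<close>
  define unsat where "unsat S e \<longleftrightarrow>
    (\<forall>j\<in>J. real (card {e'\<in>g S. e' j = e j}) < \<tau> * D * \<mu> (e j))" for S e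
  define low where "low S = {v \<in> U. real (card {e\<in>E. e z = v \<and> unsat S e}) \<le> \<eta> * D * \<mu> v}" for S
  define cont where "cont S C j = (if j = z then C0 z \<inter> (S \<union> low S) else C0 j \<inter> C j)" for S C j
  define \<C> where "\<C> = (\<Union>S\<in>\<S>. cont S ` \<D> S)"

  have "finite \<C>" using f\<S> \<D>(1) by (simp add: \<C>_def)
  moreover have "real (card \<C>) \<le> L * K"
  proof -
    have "card \<C> \<le> (\<Sum>S\<in>\<S>. card (cont S ` \<D> S))" unfolding \<C>_def by (rule card_UN_le[OF f\<S>])
    also have "real \<dots> \<le> (\<Sum>S\<in>\<S>. K)"
      unfolding of_nat_sum
    proof (rule sum_mono)
      fix S assume "S \<in> \<S>"
      then show "real (card (cont S ` \<D> S)) \<le> K"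
        using card_image_le[OF \<D>(1), of S "cont S"] \<D>(2)[of S] by linarith
    qed
    also have "\<dots> \<le> L * K" using card\<S> K by (simp add: mult_right_mono)
    finally show ?thesis by simp
  qed
  moreover have "(\<forall>j\<in>insert z J. C j \<subseteq> C0 j) \<and>
        (real (card (edges_in (insert z J) E C))
            \<le> (2 * \<tau> / \<eta> + \<eta> + 4 * real (card J) * \<delta>) * D * sum \<mu> U \<or>
         \<delta> * sum \<mu> U \<le> (\<Sum>j\<in>J. sum \<mu> (C0 j - C j)))" if "C \<in> \<C>" for C
  proof -
    obtain S C' where S: "S \<in> \<S>" and C': "C' \<in> \<D> S" and C: "C = cont S C'"
      using \<open>C \<in> \<C>\<close> unfolding \<C>_def by blast
    have SU: "S \<subseteq> U" and gs: "g S \<subseteq> E" using g[OF S] by (auto simp: valid_def)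
    have gdeg: "real (card {e\<in>g S. e j = u}) \<le> 2 * \<tau> * D * \<mu> u" if "j \<in> J" "u \<in> U" for j u
      using g[OF S] that by (simp add: valid_def)
    have sub: "\<forall>j\<in>insert z J. C j \<subseteq> C0 j" by (auto simp: C cont_def)
    have CJ: "C j = C0 j \<inter> C' j" if "j \<in> J" for j using that J by (auto simp: C cont_def)
    \<comment> \<open>A sparse \<open>g S\<close> saturates little weight. An edge inside the
      container passes through \<open>S\<close>, or is unsaturated with its \<open>z\<close>-vertex
      in \<open>low S\<close>, or meets a saturated vertex; the three kinds account for the three
      summands.\<close>
    have "real (card (edges_in (insert z J) E C))
            \<le> (2 * \<tau> / \<eta> + \<eta> + 4 * real (card J) * \<delta>) * D * sum \<mu> U"
      if few: "real (card (g S)) < 4 * \<delta> * \<tau> * D * M"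
    proof -
      define sat where "sat j = {u\<in>U. \<tau> * D * \<mu> u \<le> real (card {e'\<in>g S. e' j = u})}" for j
      have fsat: "finite (sat j)" "sat j \<subseteq> U" for j using U by (auto simp: sat_def)
      have wsat: "sum \<mu> (sat j) \<le> 4 * \<delta> * M" for j
      proof -
        have "\<tau> * D * sum \<mu> (sat j) \<le> real (card (g S))"
          by (rule weight_le_card[OF fg[OF S] fsat(1), where f = "\<lambda>e. e j"]) (auto simp: sat_def)
        then have "(\<tau> * D) * sum \<mu> (sat j) \<le> (\<tau> * D) * (4 * \<delta> * M)" using few by (simp add: ac_simps)
        then show ?thesis using pos D by simp
      qed
      let ?X = "{e\<in>E. e z \<in> S}" and ?Y = "{e\<in>{e\<in>E. unsat S e}. e z \<in> low S}"
      let ?Z = "\<lambda>j. {e\<in>E. e j \<in> sat j}"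
      have cover: "edges_in (insert z J) E C \<subseteq> ?X \<union> ?Y \<union> (\<Union>j\<in>J. ?Z j)"
      proof
        fix e assume e: "e \<in> edges_in (insert z J) E C"
        then have eE: "e \<in> E" "e z \<in> S \<union> low S" by (auto simp: edges_in_def C cont_def)
        show "e \<in> ?X \<union> ?Y \<union> (\<Union>j\<in>J. ?Z j)"
        proof (cases "unsat S e")
          case True then show ?thesis using eE by auto
        next
          case False
          then obtain j where "j \<in> J" "\<tau> * D * \<mu> (e j) \<le> real (card {e'\<in>g S. e' j = e j})"
            by (auto simp: unsat_def not_less)
          then show ?thesis using eE EU by (auto simp: sat_def)
        qed
      qed
      have X: "real (card ?X) \<le> D * (2 * \<tau> / \<eta> * M)"
      proof -
        have "real (card ?X) \<le> D * sum \<mu> S"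
          using deg SU U by (intro card_le_weight fE) (auto intro: finite_subset)
        also have "\<dots> \<le> D * (2 * \<tau> / \<eta> * M)" using wtS[OF S] D by (intro mult_left_mono) auto
        finally show ?thesis .
      qed
      have Y: "real (card ?Y) \<le> \<eta> * D * M"
      proof -
        have "real (card ?Y) \<le> \<eta> * D * sum \<mu> (low S)"
        proof (rule card_le_weight)
          fix u assume "u \<in> low S"
          moreover have "{e \<in> {e \<in> E. unsat S e}. e z = u} = {e\<in>E. e z = u \<and> unsat S e}" by auto
          ultimately show "real (card {e \<in> {e \<in> E. unsat S e}. e z = u}) \<le> \<eta> * D * \<mu> u"
            by (simp add: low_def)
        qed (use fE U in \<open>auto simp: low_def\<close>)
        also have "\<dots> \<le> \<eta> * D * M" unfolding M_def
          using pos D by (intro mult_left_mono wt_mono) (auto simp: low_def)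
        finally show ?thesis .
      qed
      have Z: "real (card (?Z j)) \<le> D * (4 * \<delta> * M)" if "j \<in> J" for j
      proof -
        have "real (card (?Z j)) \<le> D * sum \<mu> (sat j)"
          using deg that fsat(1) subsetD[OF fsat(2)[of j]] by (intro card_le_weight fE) auto
        also have "\<dots> \<le> D * (4 * \<delta> * M)" using wsat D by (intro mult_left_mono) auto
        finally show ?thesis .
      qed
      have "card (edges_in (insert z J) E C) \<le> card (?X \<union> ?Y \<union> (\<Union>j\<in>J. ?Z j))"
        using fE J by (intro card_mono cover) auto
      also have "\<dots> \<le> card ?X + card ?Y + (\<Sum>j\<in>J. card (?Z j))"
        using card_Un_le[of "?X \<union> ?Y" "\<Union>j\<in>J. ?Z j"] card_Un_le[of ?X ?Y] card_UN_le[OF J(1), of ?Z]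
        by linarith
      also have "real \<dots> \<le> D * (2 * \<tau> / \<eta> * M) + \<eta> * D * M + (\<Sum>j\<in>J. D * (4 * \<delta> * M))"
        unfolding of_nat_add of_nat_sum using X Y Z by (intro add_mono sum_mono) auto
      also have "\<dots> = (2 * \<tau> / \<eta> + \<eta> + 4 * real (card J) * \<delta>) * D * M"
        by (simp add: algebra_simps)
      finally show ?thesis by (simp add: M_def)
    qed
    \<comment> \<open>A dense \<open>g S\<close> has at least 4 \<delta> \<tau> D M edges, of which
      its container keeps at most half. The rest pass through discarded vertices, whose degrees are
      at most 2 \<tau> D \<mu>, so weight at least \<delta> M is discarded.\<close>
    moreover have "\<delta> * sum \<mu> U \<le> (\<Sum>j\<in>J. sum \<mu> (C0 j - C j))"
      if many: "\<not> real (card (g S)) < 4 * \<delta> * \<tau> * D * M"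
    proof -
      let ?Z = "\<lambda>j. {e\<in>g S. e j \<in> C0 j - C j}"
      have "g S \<subseteq> edges_in J (g S) C' \<union> (\<Union>j\<in>J. ?Z j)"
      proof
        fix e assume e: "e \<in> g S"
        then have "e j \<in> C0 j" if "j \<in> J" for j using gs E0 that by blast
        then show "e \<in> edges_in J (g S) C' \<union> (\<Union>j\<in>J. ?Z j)" using e by (auto simp: edges_in_def CJ)
      qed
      then have "card (g S) \<le> card (edges_in J (g S) C' \<union> (\<Union>j\<in>J. ?Z j))"
        using fg[OF S] J by (intro card_mono) (auto simp: edges_in_def)
      also have "\<dots> \<le> card (edges_in J (g S) C') + (\<Sum>j\<in>J. card (?Z j))"
        using card_Un_le[of "edges_in J (g S) C'" "\<Union>j\<in>J. ?Z j"] card_UN_le[OF J(1), of ?Z]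
        by linarith
      also have "real \<dots> \<le> \<delta> * (2 * \<tau> * D) * M + (\<Sum>j\<in>J. 2 * \<tau> * D * sum \<mu> (C0 j - C j))"
        unfolding of_nat_add of_nat_sum
      proof (intro add_mono sum_mono)
        show "real (card (edges_in J (g S) C')) \<le> \<delta> * (2 * \<tau> * D) * M" by (rule \<D>(3)[OF S C'])
        fix j assume j: "j \<in> J"
        then have "C0 j - C j \<subseteq> U" using C0 by blast
        then show "real (card (?Z j)) \<le> 2 * \<tau> * D * sum \<mu> (C0 j - C j)"
          using gdeg j U by (intro card_le_weight fg[OF S]) (auto intro: finite_subset)
      qed
      finally have "(2 * \<tau> * D) * (\<delta> * M) \<le> (2 * \<tau> * D) * (\<Sum>j\<in>J. sum \<mu> (C0 j - C j))"
        using many by (simp add: algebra_simps sum_distrib_left)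
      then show ?thesis using pos D by (simp add: M_def)
    qed
    ultimately show ?thesis using sub by blast
  qed
  moreover have "\<exists>C\<in>\<C>. \<forall>j\<in>insert z J. A j \<subseteq> C j"
    if A: "\<forall>j\<in>insert z J. A j \<subseteq> C0 j" and ind: "edges_in (insert z J) E A = {}" for A
  proof -
    have AU: "A j \<subseteq> U" if "j \<in> insert z J" for j using A C0 that by blast
    let ?T = "{S\<in>\<S>. S \<subseteq> A z}"
    \<comment> \<open>The empty fingerprint is always available, so a maximal one inside
      \<open>A z\<close> exists.\<close>
    have "valid {} {}" using pos D \<mu>0 by (auto simp: valid_def)
    then have "{} \<in> ?T" by (auto simp: \<S>_def)
    moreover have "finite ?T" using f\<S> by simp
    ultimately obtain S where S: "S \<in> \<S>" "S \<subseteq> A z" and max: "\<And>S'. S' \<in> ?T \<Longrightarrow> S \<subseteq> S' \<Longrightarrow> S = S'"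
      using finite_has_maximal[of ?T] by (metis (no_types, lifting) empty_iff mem_Collect_eq)
    \<comment> \<open>An edge of \<open>g S\<close> has its \<open>z\<close>-vertex in
      \<open>S\<close>, hence in \<open>A z\<close>; if it lay in \<open>A\<close> on
      \<open>J\<close>, it would be an edge of \<open>E\<close> inside \<open>A\<close>.\<close>
    have "edges_in J (g S) A = {}"
      using ind g[OF S(1)] S(2) by (fastforce simp: edges_in_def valid_def)
    then obtain C' where C': "C' \<in> \<D> S" "\<forall>j\<in>J. A j \<subseteq> C' j"
      using \<D>(4)[OF S(1), of A] AU by blast
    \<comment> \<open>A vertex \<open>v\<close> outside could join \<open>S\<close> together with
      all unsaturated edges through it, against maximality.\<close>
    have "A z \<subseteq> S \<union> low S"
    proof (rule ccontr)
      assume "\<not> A z \<subseteq> S \<union> low S"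
      then obtain v where v: "v \<in> A z" "v \<notin> S" "v \<notin> low S" by blast
      have vU: "v \<in> U" using v AU by blast
      let ?N = "{e\<in>E. e z = v \<and> unsat S e}"
      let ?G = "g S \<union> ?N"
      have SU: "S \<subseteq> U" and gs: "g S \<subseteq> E" and gz: "\<And>e. e \<in> g S \<Longrightarrow> e z \<in> S"
        using g[OF S(1)] by (auto simp: valid_def)
      have N: "\<eta> * D * \<mu> v < real (card ?N)" using v vU by (auto simp: low_def)
      have "valid (insert v S) ?G" unfolding valid_def
      proof (intro conjI ballI)
        show "insert v S \<subseteq> U" "?G \<subseteq> E" using SU vU gs by auto
        show "e z \<in> insert v S" if "e \<in> ?G" for e using that gz by auto
        show "\<eta> * D * sum \<mu> (insert v S) \<le> real (card ?G)"
        proof -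
          have "card ?G = card (g S) + card ?N"
            using fE fg[OF S(1)] gz v(2) by (intro card_Un_disjoint) auto
          moreover have "\<eta> * D * sum \<mu> S \<le> real (card (g S))"
            using g[OF S(1)] by (simp add: valid_def)
          moreover have "sum \<mu> (insert v S) = \<mu> v + sum \<mu> S"
            using v(2) SU U by (simp add: finite_subset)
          ultimately show ?thesis using N by (simp add: algebra_simps)
        qed
        fix j u assume j: "j \<in> J" and u: "u \<in> U"
        have zj: "z \<noteq> j" using j J by auto
        show "real (card {e\<in>?G. e j = u}) \<le> 2 * \<tau> * D * \<mu> u"
        \<comment> \<open>Only vertices \<open>u\<close> on a new edge can gain degree. Such a
          \<open>u\<close> was unsaturated, so it starts below \<tau> D \<mu> u, and the codegree of
          \<open>v\<close> and \<open>u\<close> adds at most \<kappa> D, again at most \<tau> D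
          \<mu> u.\<close>
        proof (cases "{e\<in>?N. e j = u} = {}")
          case True
          then have "{e\<in>?G. e j = u} = {e\<in>g S. e j = u}" by auto
          then show ?thesis using g[OF S(1)] j u by (simp add: valid_def)
        next
          case False
          then obtain e where "unsat S e" "e j = u" by blast
          then have 1: "real (card {e'\<in>g S. e' j = u}) < \<tau> * D * \<mu> u" using j by (auto simp: unsat_def)
          have "card {e\<in>?N. e j = u} \<le> card {e\<in>E. e z = v \<and> e j = u}"
            using fE by (intro card_mono) auto
          also have "real \<dots> \<le> \<kappa> * D" using codeg[of z j v u] j zj by auto
          also have "\<dots> \<le> \<tau> * D" using \<kappa> D by (intro mult_right_mono) auto
          also have "\<dots> \<le> \<tau> * D * \<mu> u" using \<mu>[OF u] pos D by simp
          finally have 2: "real (card {e\<in>?N. e j = u}) \<le> \<tau> * D * \<mu> u" by simp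
          have un: "{e\<in>?G. e j = u} = {e\<in>g S. e j = u} \<union> {e\<in>?N. e j = u}" by auto
          have "card {e\<in>?G. e j = u} \<le> card {e\<in>g S. e j = u} + card {e\<in>?N. e j = u}"
            unfolding un by (rule card_Un_le)
          then show ?thesis using 1 2 by linarith
        qed
      qed
      then have "insert v S \<in> ?T" using S v by (auto simp: \<S>_def)
      then show False using max[of "insert v S"] v by auto
    qed
    then have "\<forall>j\<in>insert z J. A j \<subseteq> cont S C' j" using A C' by (auto simp: cont_def)
    then show ?thesis using S C' unfolding \<C>_def by blast
  qed
  ultimately show ?thesis by (intro exI[of _ \<C>]) blast
qed

section \<open>Iterating rounds, and the hypergraph container theorem\<close>

lemma has_containers_mono:
  assumes "has_containers J B E K m" "K \<le> K'"
  shows "has_containers J B E K' m"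
proof -
  obtain \<C> where "finite \<C>" "real (card \<C>) \<le> K" "\<forall>C\<in>\<C>. real (card (edges_in J E C)) \<le> m"
    "\<forall>A. (\<forall>j\<in>J. A j \<subseteq> B j) \<longrightarrow> edges_in J E A = {} \<longrightarrow> (\<exists>C\<in>\<C>. \<forall>j\<in>J. A j \<subseteq> C j)"
    using assms(1) unfolding has_containers_def by (elim exE conjE)
  then show ?thesis unfolding has_containers_def using assms(2)
    by (intro exI[of _ \<C>] conjI) (linarith | assumption)+
qed

lemma bounded_hypergraph_subset:
  assumes "bounded_hypergraph J U \<mu> D \<kappa> E" "E' \<subseteq> E"
  shows "bounded_hypergraph J U \<mu> D \<kappa> E'"
proof -
  have fE: "finite E" using assms by (simp add: bounded_hypergraph_def)
  have le: "real (card {e\<in>E'. Q e}) \<le> x" if "real (card {e\<in>E. Q e}) \<le> x" for Q x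
  proof -
    have "card {e\<in>E'. Q e} \<le> card {e\<in>E. Q e}" using fE assms(2) by (intro card_mono) auto
    then show ?thesis using that by linarith
  qed
  show ?thesis
    unfolding bounded_hypergraph_def
  proof (intro conjI ballI allI impI)
    show "finite E'" using fE assms(2) by (rule rev_finite_subset)
    show "e j \<in> U" if "e \<in> E'" "j \<in> J" for e j
      using that assms by (auto simp: bounded_hypergraph_def)
    show "real (card {e\<in>E'. e j = u}) \<le> D * \<mu> u" if "j \<in> J" "u \<in> U" for j u
      using that assms(1) by (intro le) (auto simp: bounded_hypergraph_def)
    show "real (card {e\<in>E'. e i = u \<and> e j = v}) \<le> \<kappa> * D" if "i \<in> J" "j \<in> J" "i \<noteq> j" for i j u v
      using that assms(1) by (intro le) (auto simp: bounded_hypergraph_def)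
  qed
qed

text \<open>The total weight over all positions is a potential: a round that does not end with few
  edges lowers it by \<theta>. This gives a tree of depth at most \<open>s\<close> with branching at
  most \<open>B\<close>. At potential 0 the sets are empty, because \<mu> \<ge> 1, so no edges
  remain.\<close>

lemma container_iterate:
  fixes \<mu> :: "'u \<Rightarrow> real" and C0 :: "'j \<Rightarrow> 'u set"
  assumes J: "finite J" "J \<noteq> {}" and U: "finite U" and \<mu>: "\<And>u. u \<in> U \<Longrightarrow> \<mu> u \<ge> 1"
    and B: "B \<ge> 1" and m: "m \<ge> 0"
    and round: "\<And>C0. (\<forall>j\<in>J. C0 j \<subseteq> U) \<Longrightarrow> \<exists>\<C>. finite \<C> \<and> real (card \<C>) \<le> B \<and>
      (\<forall>C\<in>\<C>. (\<forall>j\<in>J. C j \<subseteq> C0 j) \<and> (real (card (edges_in J E C)) \<le> m \<or>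
         (\<Sum>j\<in>J. sum \<mu> (C j)) + \<theta> \<le> (\<Sum>j\<in>J. sum \<mu> (C0 j)))) \<and>
      (\<forall>A. (\<forall>j\<in>J. A j \<subseteq> C0 j) \<longrightarrow> edges_in J E A = {} \<longrightarrow> (\<exists>C\<in>\<C>. \<forall>j\<in>J. A j \<subseteq> C j))"
  shows "(\<forall>j\<in>J. C0 j \<subseteq> U) \<Longrightarrow> (\<Sum>j\<in>J. sum \<mu> (C0 j)) \<le> real s * \<theta> \<Longrightarrow>
    has_containers J C0 E (B ^ s) m"
proof (induction s arbitrary: C0)
  case 0
  have nn: "sum \<mu> (C0 j) \<ge> 0" if "j \<in> J" for j
    using 0 that \<mu> by (intro sum_nonneg) (force intro: order_trans[of 0 1])
  obtain j where j: "j \<in> J" using J by blast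
  have "sum \<mu> (C0 j) \<le> (\<Sum>j\<in>J. sum \<mu> (C0 j))" using j J nn by (intro member_le_sum) auto
  then have "sum \<mu> (C0 j) \<le> 0" using 0 by simp
  moreover have "real (card (C0 j)) \<le> sum \<mu> (C0 j)"
  proof -
    have "(\<Sum>u\<in>C0 j. 1) \<le> sum \<mu> (C0 j)" using 0 j \<mu> by (intro sum_mono) auto
    then show ?thesis by simp
  qed
  ultimately have "card (C0 j) = 0" by linarith
  then have "C0 j = {}" using 0 j U by (metis card_0_eq finite_subset)
  then have "edges_in J E C0 = {}" using j by (auto simp: edges_in_def)
  then show ?case unfolding has_containers_def using m
    by (intro exI[of _ "{C0}"]) auto
next
  case (Suc s)
  obtain \<C> where \<C>: "finite \<C>" "real (card \<C>) \<le> B"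
     and step: "\<And>C. C \<in> \<C> \<Longrightarrow> (\<forall>j\<in>J. C j \<subseteq> C0 j) \<and> (real (card (edges_in J E C)) \<le> m \<or>
         (\<Sum>j\<in>J. sum \<mu> (C j)) + \<theta> \<le> (\<Sum>j\<in>J. sum \<mu> (C0 j)))"
     and cov: "\<And>A. (\<forall>j\<in>J. A j \<subseteq> C0 j) \<Longrightarrow> edges_in J E A = {} \<Longrightarrow> \<exists>C\<in>\<C>. \<forall>j\<in>J. A j \<subseteq> C j"
    using round[OF Suc.prems(1)] by (elim exE conjE) blast
  have Bs: "1 \<le> B ^ s" using B by simp
  \<comment> \<open>A container that already has few edges is kept as a one-element family, which
    \<open>1 \<le> B ^ s\<close> allows.\<close>
  have sub: "has_containers J C E (B ^ s) m" if C: "C \<in> \<C>" for C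
  proof (cases "real (card (edges_in J E C)) \<le> m")
    case True
    then show ?thesis unfolding has_containers_def using Bs by (intro exI[of _ "{C}"]) auto
  next
    case False
    then have "(\<Sum>j\<in>J. sum \<mu> (C j)) + \<theta> \<le> (\<Sum>j\<in>J. sum \<mu> (C0 j))" using step[OF C] by blast
    then have "(\<Sum>j\<in>J. sum \<mu> (C j)) \<le> real s * \<theta>" using Suc.prems(2) by (simp add: algebra_simps)
    moreover have "\<forall>j\<in>J. C j \<subseteq> U" using step[OF C] Suc.prems(1) by blast
    ultimately show ?thesis using Suc.IH by blast
  qed
  then have "\<forall>C\<in>\<C>. \<exists>\<D>. finite \<D> \<and> real (card \<D>) \<le> B ^ s \<and>
      (\<forall>C'\<in>\<D>. real (card (edges_in J E C')) \<le> m) \<and>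
      (\<forall>A. (\<forall>j\<in>J. A j \<subseteq> C j) \<longrightarrow> edges_in J E A = {} \<longrightarrow> (\<exists>C'\<in>\<D>. \<forall>j\<in>J. A j \<subseteq> C' j))"
    unfolding has_containers_def by blast
  from bchoice[OF this] obtain \<D> where
    "\<forall>C\<in>\<C>. finite (\<D> C) \<and> real (card (\<D> C)) \<le> B ^ s \<and>
      (\<forall>C'\<in>\<D> C. real (card (edges_in J E C')) \<le> m) \<and>
      (\<forall>A. (\<forall>j\<in>J. A j \<subseteq> C j) \<longrightarrow> edges_in J E A = {} \<longrightarrow> (\<exists>C'\<in>\<D> C. \<forall>j\<in>J. A j \<subseteq> C' j))" ..
  then have \<D>: "\<And>C. C \<in> \<C> \<Longrightarrow> finite (\<D> C)" "\<And>C. C \<in> \<C> \<Longrightarrow> real (card (\<D> C)) \<le> B ^ s"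
    "\<And>C C'. C \<in> \<C> \<Longrightarrow> C' \<in> \<D> C \<Longrightarrow> real (card (edges_in J E C')) \<le> m"
    "\<And>C A. C \<in> \<C> \<Longrightarrow> (\<forall>j\<in>J. A j \<subseteq> C j) \<Longrightarrow> edges_in J E A = {} \<Longrightarrow> \<exists>C'\<in>\<D> C. \<forall>j\<in>J. A j \<subseteq> C' j"
    by simp_all
  have "card (\<Union>(\<D> ` \<C>)) \<le> (\<Sum>C\<in>\<C>. card (\<D> C))" by (rule card_UN_le[OF \<C>(1)])
  also have "real \<dots> \<le> (\<Sum>C\<in>\<C>. B ^ s)" unfolding of_nat_sum using \<D> by (intro sum_mono) auto
  also have "\<dots> \<le> B * B ^ s" using \<C> Bs by simp
  finally have "real (card (\<Union>(\<D> ` \<C>))) \<le> B ^ Suc s" by simp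
  moreover have "\<exists>C'\<in>\<Union>(\<D> ` \<C>). \<forall>j\<in>J. A j \<subseteq> C' j"
    if A: "\<forall>j\<in>J. A j \<subseteq> C0 j" "edges_in J E A = {}" for A
  proof -
    obtain C where C: "C \<in> \<C>" "\<forall>j\<in>J. A j \<subseteq> C j" using cov[OF A] ..
    obtain C' where "C' \<in> \<D> C" "\<forall>j\<in>J. A j \<subseteq> C' j" using \<D>(4)[OF C A(2)] ..
    then show ?thesis using C(1) by (intro bexI[of _ C'] UN_I)
  qed
  moreover have "finite (\<Union>(\<D> ` \<C>))" using \<C> \<D>(1) by simp
  moreover have "\<forall>C\<in>\<Union>(\<D> ` \<C>). real (card (edges_in J E C)) \<le> m" using \<D>(3) by fast
  ultimately show ?case
    unfolding has_containers_def by (intro exI[of _ "\<Union>(\<D> ` \<C>)"] conjI allI impI) assumption+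
qed

lemma edges_in_nested:
  assumes "\<And>j. j \<in> J \<Longrightarrow> C j \<subseteq> C0 j"
  shows "edges_in J (edges_in J E C0) C = edges_in J E C"
  using assms by (auto simp: edges_in_def)

text \<open>Induction on the positions, each step iterating the fingerprint round. It matters that
  \<kappa> is fixed before \<open>U\<close>, \<mu>, \<open>D\<close> and \<open>E\<close>: the
  induction hypothesis is used at the smaller scale 2 \<tau> D and for every hypergraph
  \<open>g S\<close>.\<close>

theorem hypergraph_containers:
  fixes J :: "'j set" and \<epsilon> \<delta> :: real
  assumes "finite J" "J \<noteq> {}" "\<epsilon> > 0" "\<delta> > 0"
  shows "\<exists>\<kappa>>0. \<forall>(U :: 'u set) \<mu> D E. finite U \<longrightarrow> (\<forall>u\<in>U. 1 \<le> \<mu> u) \<longrightarrow> 0 < D \<longrightarrow>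
    bounded_hypergraph J U \<mu> D \<kappa> E \<longrightarrow>
    has_containers J (\<lambda>_. U) E (2 powr (\<epsilon> * sum \<mu> U)) (\<delta> * D * sum \<mu> U)"
  using assms
proof (induction J arbitrary: \<epsilon> \<delta> rule: finite_ne_induct)
  case (singleton x)
  have "has_containers {x} (\<lambda>_. U) E (2 powr (\<epsilon> * sum \<mu> U)) (\<delta> * D * sum \<mu> U)"
    if \<mu>: "\<forall>u\<in>U. 1 \<le> \<mu> u" and D: "0 < D" for U :: "'u set" and \<mu> D E
  proof -
    have s: "sum \<mu> U \<ge> 0" using \<mu> by (intro sum_nonneg) (force intro: order_trans[of 0 1])
    \<comment> \<open>With a single position, the independent sets are those avoiding every vertex
      hit by an edge, so one container suffices.\<close>
    let ?C = "\<lambda>_::'j. {u. \<forall>e\<in>E. e x \<noteq> u}"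
    have "edges_in {x} E ?C = {}" by (auto simp: edges_in_def)
    moreover have "1 \<le> 2 powr (\<epsilon> * sum \<mu> U)" using s singleton by (intro ge_one_powr_ge_zero) auto
    ultimately show ?thesis unfolding has_containers_def using s singleton D
      by (intro exI[of _ "{?C}"]) (simp, auto simp: edges_in_def)
  qed
  then show ?case by (intro exI[of _ 1]) auto
next
  case (insert z J)
  let ?J = "insert z J"
  \<comment> \<open>The edge bound of a round has the summands 2 \<tau> / \<eta>, \<eta> and 4 |J|
    \<delta>'; the constants here and \<tau> below make each at most \<delta>/4.\<close>
  define \<eta> where "\<eta> = \<delta> / 4"
  define \<delta>' where "\<delta>' = \<delta> / (16 * real (card J))"
  have cJ: "card J > 0" using insert by (simp add: card_gt_0_iff)
  have \<eta>: "\<eta> > 0" and \<delta>': "\<delta>' > 0" "4 * real (card J) * \<delta>' = \<delta> / 4"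
    using insert cJ by (auto simp: \<eta>_def \<delta>'_def)
  \<comment> \<open>The initial weight over all positions is |insert z J| M and an unfinished round
    loses \<delta>' M, so \<open>s\<close> rounds exhaust it.\<close>
  define s where "s = nat \<lceil>real (card ?J) / \<delta>'\<rceil>"
  have s: "real (card ?J) \<le> real s * \<delta>'"
  proof -
    have "real (card ?J) / \<delta>' \<le> real s" unfolding s_def by (rule real_nat_ceiling_ge)
    then show ?thesis using \<delta>'(1) by (simp add: pos_divide_le_eq)
  qed
  \<comment> \<open>A round costs two factors 2 powr (\<epsilon>' M), one for the fingerprints and
    one for the containers of the smaller hypergraph; \<open>s\<close> rounds must stay within
    \<epsilon> M.\<close>
  define \<epsilon>' where "\<epsilon>' = \<epsilon> / (2 * (real s + 1))"
  have \<epsilon>': "\<epsilon>' > 0" "real s * (2 * \<epsilon>') \<le> \<epsilon>" using insert by (auto simp: \<epsilon>'_def field_simps)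
  obtain \<sigma> where \<sigma>: "\<sigma> > 0" "\<And>(U::'u set) M. finite U \<Longrightarrow> real (card U) \<le> M \<Longrightarrow>
       real (card {S. S \<subseteq> U \<and> real (card S) \<le> \<sigma> * M}) \<le> 2 powr (\<epsilon>' * M)"
    using card_small_subsets[OF \<epsilon>'(1)] by blast
  obtain \<kappa>' where \<kappa>': "\<kappa>' > 0" and IH: "\<And>(U :: 'u set) \<mu> D E. finite U \<Longrightarrow> (\<forall>u\<in>U. 1 \<le> \<mu> u) \<Longrightarrow> 0 < D \<Longrightarrow>
    bounded_hypergraph J U \<mu> D \<kappa>' E \<Longrightarrow>
    has_containers J (\<lambda>_. U) E (2 powr (\<epsilon>' * sum \<mu> U)) (\<delta>' * D * sum \<mu> U)"
    using insert.IH[OF \<epsilon>'(1) \<delta>'(1)] by blast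
  \<comment> \<open>Makes 2 \<tau> / \<eta> equal to the minimum: \<delta>/4 limits the edges
    through the fingerprint, \<sigma> limits its size.\<close>
  define \<tau> where "\<tau> = min (\<delta> / 4) \<sigma> * \<eta> / 2"
  have \<tau>: "\<tau> > 0" using \<eta> \<sigma> insert by (simp add: \<tau>_def)
  have \<tau>\<eta>: "2 * \<tau> / \<eta> = min (\<delta> / 4) \<sigma>" using \<eta> by (simp add: \<tau>_def)
  define \<kappa> where "\<kappa> = min \<tau> (2 * \<tau> * \<kappa>')"
  have \<kappa>: "\<kappa> > 0" "\<kappa> \<le> \<tau>" "\<kappa> \<le> 2 * \<tau> * \<kappa>'" using \<tau> \<kappa>' by (auto simp: \<kappa>_def)
  have "has_containers ?J (\<lambda>_. U) E (2 powr (\<epsilon> * sum \<mu> U)) (\<delta> * D * sum \<mu> U)"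
    if U: "finite U" and \<mu>: "\<forall>u\<in>U. 1 \<le> \<mu> u" and D: "0 < D" and H: "bounded_hypergraph ?J U \<mu> D \<kappa> E"
    for U :: "'u set" and \<mu> D E
  proof -
    define M where "M = sum \<mu> U"
    have cU: "real (card U) \<le> M"
    proof -
      have "(\<Sum>u\<in>U. 1) \<le> sum \<mu> U" using \<mu> by (intro sum_mono) auto
      then show ?thesis by (simp add: M_def)
    qed
    have M: "M \<ge> 0" using cU by linarith
    let ?B = "2 powr (\<epsilon>' * M) * 2 powr (\<epsilon>' * M)"
    have B: "1 \<le> ?B" using M \<epsilon>' by (simp add: powr_add[symmetric] ge_one_powr_ge_zero)
    have small: "real (card {S. S \<subseteq> U \<and> real (card S) \<le> 2 * \<tau> / \<eta> * sum \<mu> U}) \<le> 2 powr (\<epsilon>' * M)"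
    proof -
      have "card {S. S \<subseteq> U \<and> real (card S) \<le> 2 * \<tau> / \<eta> * M}
          \<le> card {S. S \<subseteq> U \<and> real (card S) \<le> \<sigma> * M}"
      proof (intro card_mono)
        have "2 * \<tau> / \<eta> * M \<le> \<sigma> * M" unfolding \<tau>\<eta> using M by (intro mult_right_mono) auto
        then show "{S. S \<subseteq> U \<and> real (card S) \<le> 2 * \<tau> / \<eta> * M} \<subseteq> {S. S \<subseteq> U \<and> real (card S) \<le> \<sigma> * M}"
          by auto
      qed (use U in simp)
      then show ?thesis using \<sigma>(2)[OF U cU] unfolding M_def by linarith
    qed
    have const: "(2 * \<tau> / \<eta> + \<eta> + 4 * real (card J) * \<delta>') * D * M \<le> \<delta> * D * M"
      unfolding \<tau>\<eta> \<delta>'(2) using M D insert.prems by (intro mult_right_mono) (auto simp: \<eta>_def)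
    have "has_containers ?J (\<lambda>_. U) E (?B ^ s) (\<delta> * D * M)"
    proof (rule container_iterate[where U = U and \<mu> = \<mu> and \<theta> = "\<delta>' * M"])
      show "(\<Sum>j\<in>?J. sum \<mu> U) \<le> real s * (\<delta>' * M)"
        using mult_right_mono[OF s M] by (simp add: M_def ac_simps)
      show "0 \<le> \<delta> * D * M" using M D insert.prems by simp
      fix C0 :: "'j \<Rightarrow> 'u set" assume C0: "\<forall>j\<in>?J. C0 j \<subseteq> U"
      let ?E = "edges_in ?J E C0"
      have "bounded_hypergraph ?J U \<mu> D \<kappa> ?E"
        by (rule bounded_hypergraph_subset[OF H]) (auto simp: edges_in_def)
      note H0 = this
      have "\<exists>\<C>. finite \<C> \<and> real (card \<C>) \<le> ?B \<and>
        (\<forall>C\<in>\<C>. (\<forall>j\<in>?J. C j \<subseteq> C0 j) \<and> (real (card (edges_in ?J ?E C))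
            \<le> (2 * \<tau> / \<eta> + \<eta> + 4 * real (card J) * \<delta>') * D * sum \<mu> U \<or>
         \<delta>' * sum \<mu> U \<le> (\<Sum>j\<in>J. sum \<mu> (C0 j - C j)))) \<and>
        (\<forall>A. (\<forall>j\<in>?J. A j \<subseteq> C0 j) \<longrightarrow> edges_in ?J ?E A = {} \<longrightarrow>
          (\<exists>C\<in>\<C>. \<forall>j\<in>?J. A j \<subseteq> C j))"
      proof (rule container_round[OF insert.hyps(1-3) U _ _ D])
        show "has_containers J (\<lambda>_. U) G (2 powr (\<epsilon>' * M)) (\<delta>' * (2 * \<tau> * D) * sum \<mu> U)"
          if "bounded_hypergraph J U \<mu> (2 * \<tau> * D) \<kappa>' G" for G
          using IH[OF U \<mu> _ that] \<tau> D by (simp add: M_def)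
        show "e j \<in> C0 j" if "e \<in> ?E" "j \<in> ?J" for e j
          using that by (auto simp: edges_in_def)
      qed (use H0 \<mu> C0 small \<eta> \<tau> \<delta>'(1) \<kappa> in auto)
      then obtain \<C> where \<C>: "finite \<C>" "real (card \<C>) \<le> ?B"
        "\<And>C. C \<in> \<C> \<Longrightarrow> (\<forall>j\<in>?J. C j \<subseteq> C0 j) \<and> (real (card (edges_in ?J ?E C))
            \<le> (2 * \<tau> / \<eta> + \<eta> + 4 * real (card J) * \<delta>') * D * M \<or>
         \<delta>' * M \<le> (\<Sum>j\<in>J. sum \<mu> (C0 j - C j)))"
        "\<And>A. (\<forall>j\<in>?J. A j \<subseteq> C0 j) \<Longrightarrow> edges_in ?J ?E A = {} \<Longrightarrow>
          (\<exists>C\<in>\<C>. \<forall>j\<in>?J. A j \<subseteq> C j)"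
        unfolding M_def[symmetric] by (elim exE conjE) blast
      have "(\<forall>j\<in>?J. C j \<subseteq> C0 j) \<and> (real (card (edges_in ?J E C)) \<le> \<delta> * D * M \<or>
         (\<Sum>j\<in>?J. sum \<mu> (C j)) + \<delta>' * M \<le> (\<Sum>j\<in>?J. sum \<mu> (C0 j)))" if C: "C \<in> \<C>" for C
      proof -
        have sub: "C j \<subseteq> C0 j" if "j \<in> ?J" for j using \<C>(3)[OF C] that by blast
        have fin: "finite (C0 j)" if "j \<in> ?J" for j using C0 U that finite_subset by blast
        have diff: "sum \<mu> (C j) + sum \<mu> (C0 j - C j) = sum \<mu> (C0 j)" if "j \<in> ?J" for j
          using sum.subset_diff[OF sub[OF that] fin[OF that], of \<mu>] by simp
        \<comment> \<open>The round guarantees a loss only over \<open>J\<close>; a loss at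
          \<open>z\<close> can only help.\<close>
        have "sum \<mu> (C0 z - C z) \<ge> 0"
          using \<mu> C0 by (intro sum_nonneg) (force intro: order_trans[of 0 1])
        then have "(\<Sum>j\<in>J. sum \<mu> (C0 j - C j)) \<le> (\<Sum>j\<in>?J. sum \<mu> (C0 j - C j))"
          using insert.hyps by simp
        moreover have "(\<Sum>j\<in>?J. sum \<mu> (C j)) + (\<Sum>j\<in>?J. sum \<mu> (C0 j - C j)) = (\<Sum>j\<in>?J. sum \<mu> (C0 j))"
          unfolding sum.distrib[symmetric] by (intro sum.cong refl diff)
        ultimately have *: "\<delta>' * M \<le> (\<Sum>j\<in>J. sum \<mu> (C0 j - C j)) \<Longrightarrow>
            (\<Sum>j\<in>?J. sum \<mu> (C j)) + \<delta>' * M \<le> (\<Sum>j\<in>?J. sum \<mu> (C0 j))"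
          by linarith
        have eq: "edges_in ?J ?E C = edges_in ?J E C" by (rule edges_in_nested[OF sub])
        from \<C>(3)[OF C] have "real (card (edges_in ?J E C)) \<le> \<delta> * D * M \<or>
            (\<Sum>j\<in>?J. sum \<mu> (C j)) + \<delta>' * M \<le> (\<Sum>j\<in>?J. sum \<mu> (C0 j))"
          unfolding eq using * order_trans[OF _ const] by blast
        then show ?thesis using sub by blast
      qed
      moreover have "\<exists>C\<in>\<C>. \<forall>j\<in>?J. A j \<subseteq> C j"
        if A: "\<forall>j\<in>?J. A j \<subseteq> C0 j" "edges_in ?J E A = {}" for A
      proof -
        have "edges_in ?J ?E A = {}" using A(2) by (auto simp: edges_in_def)
        then show ?thesis using \<C>(4) A(1) by blast
      qed
      ultimately show "\<exists>\<C>. finite \<C> \<and> real (card \<C>) \<le> ?B \<and>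
        (\<forall>C\<in>\<C>. (\<forall>j\<in>?J. C j \<subseteq> C0 j) \<and> (real (card (edges_in ?J E C)) \<le> \<delta> * D * M \<or>
         (\<Sum>j\<in>?J. sum \<mu> (C j)) + \<delta>' * M \<le> (\<Sum>j\<in>?J. sum \<mu> (C0 j)))) \<and>
        (\<forall>A. (\<forall>j\<in>?J. A j \<subseteq> C0 j) \<longrightarrow> edges_in ?J E A = {} \<longrightarrow> (\<exists>C\<in>\<C>. \<forall>j\<in>?J. A j \<subseteq> C j))"
        using \<C>(1,2) by (intro exI[of _ \<C>] conjI ballI allI impI) blast+
    qed (use insert.hyps U \<mu> B in auto)
    moreover have "?B ^ s \<le> 2 powr (\<epsilon> * M)"
    proof -
      have "?B ^ s = 2 powr (real s * (2 * \<epsilon>') * M)"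
        by (simp add: powr_add[symmetric] powr_power algebra_simps)
      also have "\<dots> \<le> 2 powr (\<epsilon> * M)" using \<epsilon>'(2) M by (intro powr_mono mult_right_mono) auto
      finally show ?thesis .
    qed
    ultimately show ?thesis unfolding M_def by (rule has_containers_mono)
  qed
  then show ?case using \<kappa>(1) by (intro exI[of _ \<kappa>] conjI allI impI)
qed

section \<open>Containers for good ssees\<close>

lemma ssee_finite_embeddings:
  assumes "ssee V E" "N \<le> n"
  shows "finite (E N n)"
proof (rule finite_subset)
  show "E N n \<subseteq> V N \<rightarrow>\<^sub>E V n" using assms unfolding ssee_def by blast
  show "finite (V N \<rightarrow>\<^sub>E V n)" using assms by (intro finite_PiE) (auto simp: ssee_def)
qed

text \<open>Two embeddings agreeing at \<open>i\<close> and \<open>j\<close> have images meeting in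
  at least two elements. If the images differ, the pair is counted by the intersection count;
  otherwise \<psi> maps into the image of \<phi>, which leaves at most r^r choices, where r = |V
  N|.\<close>

lemma card_codegree_pairs_le:
  assumes S: "ssee V E" and Nn: "N \<le> n" and ij: "i \<in> V N" "j \<in> V N" "i \<noteq> j"
  shows "card {(\<phi>, \<psi>). \<phi> \<in> E N n \<and> \<psi> \<in> E N n \<and> \<psi> i = \<phi> i \<and> \<psi> j = \<phi> j}
     \<le> intersection_count V E N n + card (V N) ^ card (V N) * card (E N n)"
proof -
  have finV: "finite (V m)" for m using S by (simp add: ssee_def)
  have emb: "\<phi> \<in> V N \<rightarrow>\<^sub>E V n" "inj_on \<phi> (V N)" if "\<phi> \<in> E N n" for \<phi>
    using S Nn that by (auto simp: ssee_def)
  note finE = ssee_finite_embeddings[OF S Nn]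
  let ?X = "{(\<phi>, \<psi>). \<phi> \<in> E N n \<and> \<psi> \<in> E N n \<and> \<psi> i = \<phi> i \<and> \<psi> j = \<phi> j}"
  let ?meet = "\<lambda>\<phi> \<psi>. card (\<phi> ` V N \<inter> \<psi> ` V N)"
  let ?Y = "{(\<phi>, \<psi>). \<phi> \<in> E N n \<and> \<psi> \<in> E N n \<and> ?meet \<phi> \<psi> \<in> {1<..<card (V N)}}"
  let ?Z = "SIGMA \<phi>:E N n. V N \<rightarrow>\<^sub>E \<phi> ` V N"
  let ?I = "\<Union>m\<in>{1<..<card (V N)}. intersecting_maps V E N n m"
  have "?X \<subseteq> ?Y \<union> ?Z"
  proof (rule subrelI, rule UnCI)
    fix \<phi> \<psi> assume "(\<phi>, \<psi>) \<in> ?X" and nZ: "(\<phi>, \<psi>) \<notin> ?Z"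
    then have *: "\<phi> \<in> E N n" "\<psi> \<in> E N n" "\<psi> i = \<phi> i" "\<psi> j = \<phi> j" by auto
    have "{\<phi> i, \<phi> j} \<subseteq> \<phi> ` V N \<inter> \<psi> ` V N" using * ij by (auto simp: image_iff) metis+
    then have "card {\<phi> i, \<phi> j} \<le> ?meet \<phi> \<psi>" by (rule card_mono[rotated]) (simp add: finV)
    moreover have "\<phi> i \<noteq> \<phi> j" using emb(2)[OF *(1)] ij by (auto dest: inj_onD)
    ultimately have "1 < ?meet \<phi> \<psi>" by simp
    moreover have "?meet \<phi> \<psi> < card (V N)"
    proof -
      have "\<psi> ` V N \<noteq> \<phi> ` V N \<inter> \<psi> ` V N"
        using nZ *(1) emb(1)[OF *(2)] by (auto simp: PiE_iff)
      then have "\<phi> ` V N \<inter> \<psi> ` V N \<subset> \<psi> ` V N" by auto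
      then have "?meet \<phi> \<psi> < card (\<psi> ` V N)" by (intro psubset_card_mono) (simp_all add: finV)
      then show ?thesis using card_image[OF emb(2)[OF *(2)]] by simp
    qed
    ultimately show "(\<phi>, \<psi>) \<in> ?Y" using * by simp
  qed
  moreover have "finite ?Z" using finE finV by (intro finite_SigmaI finite_PiE) auto
  moreover have "finite ?Y" by (rule finite_subset[of _ "E N n \<times> E N n"]) (use finE in auto)
  ultimately have "card ?X \<le> card (?Y \<union> ?Z)" by (intro card_mono) auto
  also have "\<dots> \<le> card ?Y + card ?Z" by (rule card_Un_le)
  also have "card ?Z = card (V N) ^ card (V N) * card (E N n)"
  proof -
    have "card (V N \<rightarrow>\<^sub>E \<phi> ` V N) = card (V N) ^ card (V N)" if "\<phi> \<in> E N n" for \<phi>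
      using emb(2)[OF that] finV by (simp add: card_PiE card_image)
    then show ?thesis using finE finV by (subst card_SigmaI) (auto intro: finite_PiE)
  qed
  also have "card ?Y \<le> intersection_count V E N n"
  proof -
    have fI: "finite (intersecting_maps V E N n m)" for m
      by (rule finite_subset[of _ "(V N <+> V N) \<rightarrow>\<^sub>E V n"])
        (auto simp: intersecting_maps_def finV intro!: finite_PiE)
    \<comment> \<open>A pair of embeddings is glued into one map on the disjoint union, the form in
      which \<open>intersecting_maps\<close> counts them.\<close>
    have inj: "inj_on (\<lambda>(\<phi>, \<psi>). case_sum \<phi> \<psi>) ?Y"
      by (auto simp: inj_on_def fun_eq_iff split: sum.splits)
    have img: "(\<lambda>(\<phi>, \<psi>). case_sum \<phi> \<psi>) ` ?Y \<subseteq> ?I"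
    proof clarify
      fix \<phi> \<psi> assume *: "\<phi> \<in> E N n" "\<psi> \<in> E N n" "?meet \<phi> \<psi> \<in> {1<..<card (V N)}"
      have "compose (V N) (case_sum \<phi> \<psi>) Inl = \<phi>" "compose (V N) (case_sum \<phi> \<psi>) Inr = \<psi>"
        using emb(1)[OF *(1)] emb(1)[OF *(2)] by (auto simp: compose_def fun_eq_iff PiE_def extensional_def)
      moreover have "case_sum \<phi> \<psi> \<in> (V N <+> V N) \<rightarrow>\<^sub>E V n"
        using emb(1)[OF *(1)] emb(1)[OF *(2)]
        by (auto simp: PiE_def extensional_def split: sum.splits)
      moreover have "case_sum \<phi> \<psi> ` Inl ` V N \<inter> case_sum \<phi> \<psi> ` Inr ` V N = \<phi> ` V N \<inter> \<psi> ` V N"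
        by (simp add: image_image)
      ultimately have "case_sum \<phi> \<psi> \<in> intersecting_maps V E N n (?meet \<phi> \<psi>)"
        using * by (simp add: intersecting_maps_def)
      then show "case_sum \<phi> \<psi> \<in> ?I" using *(3) by blast
    qed
    have "card ?Y \<le> card ?I" by (rule card_inj_on_le[OF inj img]) (use fI in auto)
    also have "\<dots> \<le> intersection_count V E N n"
      unfolding intersection_count_def by (rule card_UN_le) simp
    finally show ?thesis .
  qed
  finally show ?thesis by simp
qed

text \<open>Goodness controls codegrees only on average. Embeddings through a pair of large codegree
  are therefore deleted; Markov's inequality shows that they are few. The container theorem treats
  the rest, and the deleted embeddings are added back to the edge count.\<close>

lemma good_ssee_containers:
  fixes V :: "nat \<Rightarrow> 'a set" and \<epsilon> \<delta> :: real
  assumes good: "good_ssee V E" and VN: "card (V N) > 1" and pos: "\<epsilon> > 0" "\<delta> > 0"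
  shows "eventually (\<lambda>n. has_containers (V N) (\<lambda>_. V n) (E N n)
           (2 powr (\<epsilon> * real (card (V n)))) (\<delta> * real (card (E N n)))) sequentially"
proof -
  have S: "ssee V E" using good by (simp add: good_ssee_def)
  have finV: "finite (V m)" for m using S by (simp add: ssee_def)
  define r where "r = card (V N)"
  have r: "r > 0" "V N \<noteq> {}" using VN by (auto simp: r_def)
  \<comment> \<open>The total weight used below is (1 + r) |V n|, hence the divisions by 1 + r. The
    extra factor 1/2 reserves half of \<delta> for the deleted embeddings.\<close>
  obtain \<kappa> where \<kappa>: "\<kappa> > 0" and cont: "\<And>(U :: 'a set) \<mu> D E. finite U \<Longrightarrow> (\<forall>u\<in>U. 1 \<le> \<mu> u) \<Longrightarrow> 0 < D \<Longrightarrow>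
    bounded_hypergraph (V N) U \<mu> D \<kappa> E \<Longrightarrow>
    has_containers (V N) (\<lambda>_. U) E (2 powr (\<epsilon> / (1 + real r) * sum \<mu> U)) (\<delta> / (2 * (1 + real r)) * D * sum \<mu> U)"
    using hypergraph_containers[OF finV r(2), of "\<epsilon> / (1 + real r)" "\<delta> / (2 * (1 + real r))", where ?'u = 'a] pos
    by auto
  let ?M = "\<lambda>n. real (card (V n))" and ?e = "\<lambda>n. real (card (E N n))"
    and ?I = "\<lambda>n. real (intersection_count V E N n)"
  have dens: "filterlim (\<lambda>n. ?e n / ?M n) at_top sequentially"
    and "(\<lambda>n. ?M n * ?I n / (?e n)\<^sup>2) \<longlonglongrightarrow> 0"
    using good VN by (auto simp: good_ssee_def)
  moreover have "(\<lambda>n. inverse (?e n / ?M n)) \<longlonglongrightarrow> 0" using dens by (rule tendsto_inverse_0_at_top)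
  \<comment> \<open>With average degree d = e/M, these are the two terms of the bound on codegree
    pairs, divided by d^2 M.\<close>
  ultimately have "(\<lambda>n. ?M n * ?I n / (?e n)\<^sup>2 + real (r ^ r) * inverse (?e n / ?M n)) \<longlonglongrightarrow> 0 + real (r ^ r) * 0"
    by (intro tendsto_intros)
  moreover have thr: "\<delta> * \<kappa> / (2 * (real r)\<^sup>2) > 0" using pos \<kappa> r by simp
  ultimately have "eventually (\<lambda>n. ?M n * ?I n / (?e n)\<^sup>2 + real (r ^ r) * inverse (?e n / ?M n)
      < \<delta> * \<kappa> / (2 * (real r)\<^sup>2)) sequentially"
    by (intro order_tendstoD(2)[of _ 0]) simp_all
  moreover have "eventually (\<lambda>n. ?e n / ?M n > 0) sequentially"
    using dens by (simp add: filterlim_at_top_dense)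
  moreover have "eventually (\<lambda>n. N \<le> n) sequentially" by (rule eventually_ge_at_top)
  ultimately show ?thesis
  proof eventually_elim
    case (elim n)
    define M where "M = real (card (V n))"
    define d where "d = real (card (E N n)) / M"
    have d: "d > 0" using elim by (simp add: d_def M_def)
    have M: "M > 0" using elim by (auto simp: M_def zero_less_divide_iff)
    have e: "real (card (E N n)) = d * M" using M by (simp add: d_def)
    have finE: "finite (E N n)" by (rule ssee_finite_embeddings[OF S elim(3)])
    have EV: "\<phi> x \<in> V n" if "\<phi> \<in> E N n" "x \<in> V N" for \<phi> x
      using S elim(3) that unfolding ssee_def by (blast dest: PiE_mem)
    let ?deg = "\<lambda>j u. real (card {\<phi>\<in>E N n. \<phi> j = u})"
    let ?codeg = "\<lambda>i j u v. card {\<phi>\<in>E N n. \<phi> i = u \<and> \<phi> j = v}"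
    \<comment> \<open>chosen so that every degree is at most \<open>d * \<mu> u\<close> while the total weight stays linear in \<open>M\<close>\<close>
    define \<mu> where "\<mu> u = 1 + (\<Sum>j\<in>V N. ?deg j u) / d" for u
    define E' where "E' = {\<phi>\<in>E N n. \<forall>i\<in>V N. \<forall>j\<in>V N. i \<noteq> j \<longrightarrow> real (?codeg i j (\<phi> i) (\<phi> j)) \<le> \<kappa> * d}"
    have sum\<mu>: "sum \<mu> (V n) = (1 + real r) * M"
    proof -
      have "(\<Sum>u\<in>V n. ?deg j u) = d * M" if "j \<in> V N" for j
      proof -
        have "{\<phi>\<in>E N n. \<phi> j \<in> V n} = E N n" using EV that by auto
        then show ?thesis
          using card_fibres[OF finE finV, of "\<lambda>\<phi>. \<phi> j" n] e by simp
      qed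
      then have "(\<Sum>u\<in>V n. \<Sum>j\<in>V N. ?deg j u) = real r * (d * M)"
        by (subst sum.swap) (simp add: r_def)
      then show ?thesis
        using d by (simp add: \<mu>_def sum.distrib sum_divide_distrib[symmetric] M_def algebra_simps)
    qed
    have bh: "bounded_hypergraph (V N) (V n) \<mu> d \<kappa> E'"
      unfolding bounded_hypergraph_def
    proof (intro conjI ballI allI impI)
      show "finite E'" using finE by (simp add: E'_def)
      show "\<phi> j \<in> V n" if "\<phi> \<in> E'" "j \<in> V N" for \<phi> j using that EV by (simp add: E'_def)
      show "real (card {\<phi>\<in>E'. \<phi> j = u}) \<le> d * \<mu> u" if "j \<in> V N" for j u
      proof -
        have "real (card {\<phi>\<in>E'. \<phi> j = u}) \<le> ?deg j u"
          using finE by (auto simp: E'_def intro!: card_mono)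
        also have "\<dots> \<le> (\<Sum>j\<in>V N. ?deg j u)" using that finV by (intro member_le_sum) auto
        also have "\<dots> \<le> d * \<mu> u" using d by (simp add: \<mu>_def field_simps)
        finally show ?thesis .
      qed
      \<comment> \<open>If some member of \<open>E'\<close> takes these two values, its own
        membership condition bounds the codegree of this very pair.\<close>
      show "real (card {\<phi>\<in>E'. \<phi> i = u \<and> \<phi> j = v}) \<le> \<kappa> * d"
        if "i \<in> V N" "j \<in> V N" "i \<noteq> j" for i j u v
      proof (cases "{\<phi>\<in>E'. \<phi> i = u \<and> \<phi> j = v} = {}")
        case True
        then have "card {\<phi>\<in>E'. \<phi> i = u \<and> \<phi> j = v} = 0" by (simp only: card.empty)
        then show ?thesis using \<kappa> d by simp
      next
        case False
        then obtain \<phi> where \<phi>: "\<phi> \<in> E'" "\<phi> i = u" "\<phi> j = v" by blast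
        have "card {\<phi>\<in>E'. \<phi> i = u \<and> \<phi> j = v} \<le> ?codeg i j u v"
          using finE by (auto simp: E'_def intro!: card_mono)
        moreover have "real (?codeg i j u v) \<le> \<kappa> * d" using \<phi> that by (auto simp: E'_def)
        ultimately show ?thesis by linarith
      qed
    qed
    have \<mu>1: "\<forall>u\<in>V n. 1 \<le> \<mu> u" using d by (auto simp: \<mu>_def intro!: divide_nonneg_pos sum_nonneg)
    have "has_containers (V N) (\<lambda>_. V n) E' (2 powr (\<epsilon> / (1 + real r) * sum \<mu> (V n)))
        (\<delta> / (2 * (1 + real r)) * d * sum \<mu> (V n))"
      by (rule cont[OF finV \<mu>1 d bh])
    moreover have "\<epsilon> / (1 + real r) * sum \<mu> (V n) = \<epsilon> * M" by (simp add: sum\<mu>)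
    moreover have "\<delta> / (2 * (1 + real r)) * d * sum \<mu> (V n) = \<delta> / 2 * (d * M)"
      by (simp add: sum\<mu> field_simps)
    ultimately have "has_containers (V N) (\<lambda>_. V n) E' (2 powr (\<epsilon> * M)) (\<delta> / 2 * (d * M))"
      by (simp only:)
    then obtain \<C> where \<C>0: "finite \<C>" "real (card \<C>) \<le> 2 powr (\<epsilon> * M)"
      "\<forall>C\<in>\<C>. real (card (edges_in (V N) E' C)) \<le> \<delta> / 2 * (d * M)"
      "\<forall>A. (\<forall>j\<in>V N. A j \<subseteq> V n) \<longrightarrow> edges_in (V N) E' A = {} \<longrightarrow> (\<exists>C\<in>\<C>. \<forall>j\<in>V N. A j \<subseteq> C j)"
      unfolding has_containers_def by (elim exE conjE)
    note \<C> = \<C>0(1,2) bspec[OF \<C>0(3)] \<C>0(4)[THEN spec, THEN mp, THEN mp]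
    have rest: "real (card (E N n - E')) \<le> \<delta> / 2 * (d * M)"
    proof -
      let ?P = "{(i, j). i \<in> V N \<and> j \<in> V N \<and> i \<noteq> j}"
      let ?bad = "\<lambda>(i, j). {\<phi>\<in>E N n. \<kappa> * d < real (?codeg i j (\<phi> i) (\<phi> j))}"
      let ?b = "?I n + real (r ^ r) * (d * M)"
      have finP: "finite ?P" by (rule finite_subset[of _ "V N \<times> V N"]) (use finV in auto)
      have cP: "real (card ?P) \<le> (real r)\<^sup>2"
      proof -
        have "card ?P \<le> card (V N \<times> V N)" using finV by (intro card_mono) auto
        then have "card ?P \<le> r * r" by (simp add: card_cartesian_product r_def)
        then have "real (card ?P) \<le> real (r * r)" by (simp only: of_nat_le_iff)
        then show ?thesis by (simp only: power2_eq_square of_nat_mult)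
      qed
      \<comment> \<open>Markov's inequality: each bad \<phi> is the first entry of more than
        \<kappa> d agreeing pairs, and there are at most \<open>?b\<close> such pairs in
        all.\<close>
      have "real (card (?bad p)) \<le> ?b / (\<kappa> * d)" if pP: "p \<in> ?P" for p
      proof -
        obtain i j where p: "p = (i, j)" and ij: "i \<in> V N" "j \<in> V N" "i \<noteq> j" using pP by blast
        let ?X = "{(\<phi>, \<psi>). \<phi> \<in> E N n \<and> \<psi> \<in> E N n \<and> \<psi> i = \<phi> i \<and> \<psi> j = \<phi> j}"
        have X: "?X = (SIGMA \<phi>:E N n. {\<psi>\<in>E N n. \<psi> i = \<phi> i \<and> \<psi> j = \<phi> j})" by auto
        have "\<kappa> * d * real (card (?bad p)) = (\<Sum>\<phi>\<in>?bad p. \<kappa> * d)" by simp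
        also have "\<dots> \<le> (\<Sum>\<phi>\<in>?bad p. real (?codeg i j (\<phi> i) (\<phi> j)))"
          by (intro sum_mono) (auto simp: p)
        also have "\<dots> \<le> (\<Sum>\<phi>\<in>E N n. real (?codeg i j (\<phi> i) (\<phi> j)))"
          using finE by (intro sum_mono2) (auto simp: p)
        also have "\<dots> = real (card ?X)" unfolding X using finE by (subst card_SigmaI) auto
        also have "\<dots> \<le> real (intersection_count V E N n + card (V N) ^ card (V N) * card (E N n))"
          using card_codegree_pairs_le[OF S elim(3) ij] by (simp only: of_nat_le_iff)
        also have "\<dots> = ?b" using e by (simp add: r_def)
        finally show ?thesis using \<kappa> d by (simp add: field_simps)
      qed
      then have "(\<Sum>p\<in>?P. real (card (?bad p))) \<le> real (card ?P) * (?b / (\<kappa> * d))"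
        by (intro sum_bounded_above)
      moreover have "card (E N n - E') \<le> (\<Sum>p\<in>?P. card (?bad p))"
      proof -
        have "card (E N n - E') \<le> card (\<Union>p\<in>?P. ?bad p)"
          using finE finP by (intro card_mono) (auto simp: E'_def not_le)
        also have "\<dots> \<le> (\<Sum>p\<in>?P. card (?bad p))" by (rule card_UN_le[OF finP])
        finally show ?thesis .
      qed
      then have "real (card (E N n - E')) \<le> (\<Sum>p\<in>?P. real (card (?bad p)))"
        by (simp only: of_nat_sum[symmetric] of_nat_le_iff)
      moreover have "real (card ?P) * (?b / (\<kappa> * d)) \<le> (real r)\<^sup>2 * (?b / (\<kappa> * d))"
        using cP \<kappa> d M by (intro mult_right_mono) auto
      moreover have "(real r)\<^sup>2 * (?b / (\<kappa> * d)) \<le> \<delta> / 2 * (d * M)"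
      proof -
        have "M * ?I n / (d * M)\<^sup>2 + real (r ^ r) * inverse d < \<delta> * \<kappa> / (2 * (real r)\<^sup>2)"
        proof -
          have "?e n / ?M n = d" by (simp add: d_def M_def)
          then show ?thesis using elim(1) unfolding M_def[symmetric] e by simp
        qed
        moreover have "M * ?I n / (d * M)\<^sup>2 + real (r ^ r) * inverse d = ?b / (d * d * M)"
          using d M by (simp add: field_simps power2_eq_square)
        ultimately have "?b / (d * d * M) < \<delta> * \<kappa> / (2 * (real r)\<^sup>2)" by simp
        then have "?b * (2 * (real r)\<^sup>2) < \<delta> * \<kappa> * (d * d * M)"
          using d M r by (simp add: divide_less_eq less_divide_eq)
        then show ?thesis using \<kappa> d by (simp add: field_simps)
      qed
      ultimately show ?thesis by linarith
    qed
    have "real (card (edges_in (V N) (E N n) C)) \<le> \<delta> * (d * M)" if "C \<in> \<C>" for C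
    proof -
      have "edges_in (V N) (E N n) C \<subseteq> edges_in (V N) E' C \<union> (E N n - E')"
        by (auto simp: edges_in_def)
      then have "card (edges_in (V N) (E N n) C) \<le> card (edges_in (V N) E' C \<union> (E N n - E'))"
        using finE by (intro card_mono) (auto simp: edges_in_def E'_def)
      also have "\<dots> \<le> card (edges_in (V N) E' C) + card (E N n - E')" by (rule card_Un_le)
      finally show ?thesis using \<C>(3)[OF that] rest by linarith
    qed
    moreover have "\<exists>C\<in>\<C>. \<forall>j\<in>V N. A j \<subseteq> C j"
      if "\<forall>j\<in>V N. A j \<subseteq> V n" "edges_in (V N) (E N n) A = {}" for A
    proof (rule \<C>(4)[OF that(1)])
      show "edges_in (V N) E' A = {}" using that(2) by (auto simp: edges_in_def E'_def)
    qed
    ultimately show ?case unfolding has_containers_def e using \<C>(1,2)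
      by (intro exI[of _ \<C>] conjI ballI allI impI) (simp_all add: M_def)
  qed
qed

section \<open>Templates and entropy\<close>

lemma card_realisations:
  assumes "finite A" "k \<ge> 2" "t \<in> templates k A"
  shows "real (card (realisations A t)) = real k powr Ent k A t"
proof -
  have t: "t x \<subseteq> {1..k}" "t x \<noteq> {}" if "x \<in> A" for x
    using assms(3) that by (auto simp: templates_def PiE_iff)
  have "real k powr log (real k) (real (card (t x))) = real (card (t x))" if "x \<in> A" for x
  proof -
    have "card (t x) > 0" using t[OF that] by (simp add: card_gt_0_iff finite_subset)
    then show ?thesis using assms(2) by simp
  qed
  then show ?thesis
    using assms by (simp add: realisations_def Ent_def card_PiE powr_sum)
qed

lemma finite_colourings: "finite A \<Longrightarrow> finite (colourings k A)"
  unfolding colourings_def by (rule finite_PiE) auto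

lemma realisations_subset_colourings:
  assumes "t \<in> templates k A"
  shows "realisations A t \<subseteq> colourings k A"
  unfolding realisations_def colourings_def
  by (rule PiE_mono) (use assms in \<open>auto simp: templates_def PiE_iff\<close>)

text \<open>For each forbidden \<open>f\<close> the level sets of an allowed colouring form an
  independent family. A container is chosen for every \<open>f\<close> simultaneously, and the
  choices are merged into one template; |F| is fixed, so the number of templates remains
  subexponential.\<close>

lemma Forb_containers:
  fixes V :: "nat \<Rightarrow> 'a set" and \<epsilon> \<delta> :: real
  assumes good: "good_ssee V E" and VN: "card (V N) > 1" and k: "k \<ge> 2"
    and F: "F \<subseteq> colourings k (V N)" and pos: "\<epsilon> > 0" "\<delta> > 0"
  shows "eventually (\<lambda>n. \<exists>\<T>. finite \<T> \<and> real (card \<T>) \<le> real k powr (\<epsilon> * real (card (V n))) \<and>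
    \<T> \<subseteq> templates k (V n) \<and>
    (\<forall>t\<in>\<T>. real (card {(\<phi>, c). \<phi> \<in> E N n \<and> c \<in> F \<and> c \<in> realisations (V N) (compose (V N) t \<phi>)})
       \<le> \<delta> * real (card (E N n))) \<and>
    Forb V E k N F n \<subseteq> (\<Union>t\<in>\<T>. realisations (V n) t)) sequentially"
proof -
  have S: "ssee V E" using good by (simp add: good_ssee_def)
  have finV: "finite (V m)" for m using S by (simp add: ssee_def)
  have finF: "finite F" using F finite_colourings[OF finV] by (rule finite_subset)
  \<comment> \<open>Dividing by \<open>q\<close> absorbs the power |F| in the number of choices and
    the sum over \<open>F\<close> of bad pairs; the +1 covers empty \<open>F\<close>.\<close>
  define q where "q = real (card F) + 1"
  have q: "q > 0" "real (card F) \<le> q" by (auto simp: q_def)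
  have "eventually (\<lambda>n. has_containers (V N) (\<lambda>_. V n) (E N n)
      (2 powr (\<epsilon> / q * real (card (V n)))) (\<delta> / q * real (card (E N n)))) sequentially"
    using pos q by (intro good_ssee_containers[OF good VN]) auto
  moreover have "eventually (\<lambda>n. N \<le> n) sequentially" by (rule eventually_ge_at_top)
  ultimately show ?thesis
  proof eventually_elim
    case (elim n)
    define M where "M = real (card (V n))"
    have finE: "finite (E N n)" by (rule ssee_finite_embeddings[OF S elim(2)])
    have EV: "\<phi> x \<in> V n" if "\<phi> \<in> E N n" "x \<in> V N" for \<phi> x
      using S elim(2) that unfolding ssee_def by (blast dest: PiE_mem)
    obtain \<C> where \<C>0: "finite \<C>" "real (card \<C>) \<le> 2 powr (\<epsilon> / q * real (card (V n)))"
      "\<forall>C\<in>\<C>. real (card (edges_in (V N) (E N n) C)) \<le> \<delta> / q * real (card (E N n))"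
      "\<forall>A. (\<forall>x\<in>V N. A x \<subseteq> V n) \<longrightarrow> edges_in (V N) (E N n) A = {} \<longrightarrow> (\<exists>C\<in>\<C>. \<forall>x\<in>V N. A x \<subseteq> C x)"
      using elim(1) unfolding has_containers_def by (elim exE conjE)
    note \<C> = \<C>0(1) \<C>0(2)[folded M_def] bspec[OF \<C>0(3)] \<C>0(4)[THEN spec, THEN mp, THEN mp]
    \<comment> \<open>Colour \<open>i\<close> is removed at \<open>u\<close> exactly when some
      \<open>f\<close> has colour \<open>i\<close> at some \<open>x\<close> whose container omits
      \<open>u\<close>.\<close>
    define T where "T h = (\<lambda>u\<in>V n. {i\<in>{1..k}. \<forall>f\<in>F. \<forall>x\<in>V N. f x = i \<longrightarrow> u \<in> h f x})"
      for h :: "('a \<Rightarrow> nat) \<Rightarrow> 'a \<Rightarrow> 'a set"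
    \<comment> \<open>\<open>T h\<close> may have empty values. Such choices are dropped; those
      coming from a colouring \<open>c\<close> survive because \<open>c u\<close> lies in
      \<open>T h u\<close>.\<close>
    define \<T> where "\<T> = T ` (F \<rightarrow>\<^sub>E \<C>) \<inter> templates k (V n)"
    have finH: "finite (F \<rightarrow>\<^sub>E \<C>)" using finF \<C> by (intro finite_PiE) auto
    have "finite \<T>" using finH by (simp add: \<T>_def)
    moreover have "real (card \<T>) \<le> real k powr (\<epsilon> * M)"
    proof -
      have "card \<T> \<le> card (T ` (F \<rightarrow>\<^sub>E \<C>))" unfolding \<T>_def using finH by (intro card_mono) auto
      also have "\<dots> \<le> card (F \<rightarrow>\<^sub>E \<C>)" by (rule card_image_le[OF finH])
      also have "\<dots> = card \<C> ^ card F" using finF by (simp add: card_PiE)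
      also have "real \<dots> \<le> (2 powr (\<epsilon> / q * M)) ^ card F"
        unfolding of_nat_power using \<C>(2) by (intro power_mono) auto
      also have "\<dots> = 2 powr (real (card F) / q * (\<epsilon> * M))" by (simp add: powr_power field_simps)
      also have "\<dots> \<le> 2 powr (1 * (\<epsilon> * M))"
        using q pos by (intro powr_mono mult_right_mono) (auto simp: M_def)
      also have "\<dots> \<le> real k powr (\<epsilon> * M)"
        using k pos by (simp add: powr_mono2 M_def)
      finally show ?thesis by simp
    qed
    moreover have "\<T> \<subseteq> templates k (V n)" by (simp add: \<T>_def)
    moreover have "real (card {(\<phi>, c). \<phi> \<in> E N n \<and> c \<in> F \<and> c \<in> realisations (V N) (compose (V N) t \<phi>)})
       \<le> \<delta> * real (card (E N n))" (is "real (card ?B) \<le> _") if t: "t \<in> \<T>" for t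
    proof -
      obtain h where h: "h \<in> F \<rightarrow>\<^sub>E \<C>" and th: "t = T h" using t by (auto simp: \<T>_def)
      let ?S = "SIGMA c:F. edges_in (V N) (E N n) (h c)"
      have finS: "finite ?S" using finF finE by (intro finite_SigmaI) (auto simp: edges_in_def)
      \<comment> \<open>The definition of \<open>T\<close>, applied with \<open>c\<close> as the
        forbidden colouring, turns \<open>c x \<in> t (\<phi> x)\<close> into
        \<open>\<phi> x \<in> h c x\<close>: a bad pair is an edge inside the container chosen for
        \<open>c\<close>.\<close>
      have "?B \<subseteq> (\<lambda>(c, \<phi>). (\<phi>, c)) ` ?S"
      proof (rule subrelI)
        fix \<phi> c assume "(\<phi>, c) \<in> ?B"
        then have *: "\<phi> \<in> E N n" "c \<in> F" and r: "c \<in> realisations (V N) (compose (V N) t \<phi>)" by auto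
        have "\<phi> x \<in> h c x" if x: "x \<in> V N" for x
        proof -
          have "c x \<in> t (\<phi> x)" using r x by (auto simp: realisations_def compose_def PiE_iff)
          then show ?thesis using x * EV by (auto simp: th T_def)
        qed
        then have "(c, \<phi>) \<in> ?S" using * by (auto simp: edges_in_def)
        then show "(\<phi>, c) \<in> (\<lambda>(c, \<phi>). (\<phi>, c)) ` ?S" by force
      qed
      then have "card ?B \<le> card ?S" by (rule surj_card_le[OF finS])
      also have "\<dots> = (\<Sum>c\<in>F. card (edges_in (V N) (E N n) (h c)))"
        using finF finE by (subst card_SigmaI) (auto simp: edges_in_def)
      also have "real \<dots> \<le> (\<Sum>c\<in>F. \<delta> / q * real (card (E N n)))"
        unfolding of_nat_sum using h by (intro sum_mono \<C>(3)) auto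
      also have "\<dots> = real (card F) / q * (\<delta> * real (card (E N n)))" by simp
      also have "\<dots> \<le> 1 * (\<delta> * real (card (E N n)))" using q pos by (intro mult_right_mono) auto
      finally show ?thesis by simp
    qed
    moreover have "c \<in> (\<Union>t\<in>\<T>. realisations (V n) t)" if c: "c \<in> Forb V E k N F n" for c
    proof -
      have cc: "c \<in> V n \<rightarrow>\<^sub>E {1..k}" using c by (simp add: Forb_def colourings_def)
      have "\<exists>C\<in>\<C>. \<forall>x\<in>V N. {u\<in>V n. c u = f x} \<subseteq> C x" if f: "f \<in> F" for f
      proof (rule \<C>(4))
        show "edges_in (V N) (E N n) (\<lambda>x. {u\<in>V n. c u = f x}) = {}"
        proof (rule ccontr)
          assume "edges_in (V N) (E N n) (\<lambda>x. {u\<in>V n. c u = f x}) \<noteq> {}"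
          then obtain \<phi> where \<phi>: "\<phi> \<in> E N n" "\<And>x. x \<in> V N \<Longrightarrow> c (\<phi> x) = f x"
            by (auto simp: edges_in_def)
          have "f \<in> extensional (V N)" using f F by (auto simp: colourings_def PiE_def)
          then have "compose (V N) c \<phi> = f"
            using \<phi>(2) by (auto simp: compose_def fun_eq_iff extensional_def)
          then show False using c \<phi>(1) f elim(2) by (auto simp: Forb_def)
        qed
      qed auto
      then obtain g where g: "\<And>f. f \<in> F \<Longrightarrow> g f \<in> \<C>"
        "\<And>f x. f \<in> F \<Longrightarrow> x \<in> V N \<Longrightarrow> {u\<in>V n. c u = f x} \<subseteq> g f x" by metis
      define h where "h = restrict g F"
      have ct: "c u \<in> T h u" if "u \<in> V n" for u
      proof -
        have "c u \<in> {1..k}" using cc that by (rule PiE_mem)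
        moreover have "u \<in> h f x" if "f \<in> F" "x \<in> V N" "f x = c u" for f x
          using g(2)[OF that(1,2)] that \<open>u \<in> V n\<close> by (auto simp: h_def)
        ultimately show ?thesis using that by (simp add: T_def)
      qed
      have "T h \<in> templates k (V n)"
        using ct unfolding templates_def by (intro PiE_I) (auto simp: T_def)
      moreover have "h \<in> F \<rightarrow>\<^sub>E \<C>" using g by (auto simp: h_def)
      ultimately have "T h \<in> \<T>" by (simp add: \<T>_def)
      moreover have "c \<in> realisations (V n) (T h)"
        using cc ct by (auto simp: realisations_def PiE_def)
      ultimately show ?thesis by blast
    qed
    ultimately show ?case unfolding M_def by (intro exI[of _ \<T>] conjI ballI subsetI) blast+
  qed
qed

section \<open>Extremal entropy and its density\<close>

lemma finite_template_entropies:
  assumes "finite A"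
  shows "finite {Ent k A t | t. t \<in> templates k A \<and> realisations A t \<subseteq> Q}"
proof -
  have "finite (templates k A)" unfolding templates_def using assms by (intro finite_PiE) auto
  then show ?thesis by simp
qed

lemma Ent_le_ex_ent:
  assumes "finite A" "t \<in> templates k A" "realisations A t \<subseteq> Q"
  shows "Ent k A t \<le> ex_ent k A Q"
  unfolding ex_ent_def by (rule Max_ge[OF finite_template_entropies[OF assms(1)]]) (use assms in blast)

text \<open>The singleton template of any member of \<open>Q\<close> is admissible with entropy 0,
  so the maximum is over a nonempty set and is nonnegative.\<close>

lemma ex_ent_attained:
  assumes A: "finite A" and Q: "Q \<noteq> {}" "Q \<subseteq> colourings k A"
  obtains t where "t \<in> templates k A" "realisations A t \<subseteq> Q" "Ent k A t = ex_ent k A Q" "ex_ent k A Q \<ge> 0"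
proof -
  obtain c where c: "c \<in> Q" using Q by blast
  let ?t = "\<lambda>x\<in>A. {c x}"
  have cc: "c \<in> A \<rightarrow>\<^sub>E {1..k}" using c Q by (auto simp: colourings_def)
  have t: "?t \<in> templates k A" using cc by (auto simp: templates_def PiE_iff)
  have "d = c" if "d \<in> realisations A ?t" for d
    using that cc by (intro extensionalityI[of d A]) (auto simp: realisations_def PiE_iff)
  then have r: "realisations A ?t \<subseteq> Q" using c by blast
  have "Ent k A ?t = 0" by (simp add: Ent_def)
  then have nn: "ex_ent k A Q \<ge> 0" using Ent_le_ex_ent[OF A t r] by simp
  have "ex_ent k A Q \<in> {Ent k A t | t. t \<in> templates k A \<and> realisations A t \<subseteq> Q}"
    unfolding ex_ent_def using t r by (intro Max_in finite_template_entropies A) blast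
  then show ?thesis using that nn by auto
qed

text \<open>The realisations of an extremal template lie in \<open>Q\<close>; this is the lower
  bound for the counting.\<close>

lemma ex_ent_le_log_card:
  assumes A: "finite A" and Q: "Q \<noteq> {}" "Q \<subseteq> colourings k A" and k: "k \<ge> 2"
  shows "ex_ent k A Q \<le> log (real k) (real (card Q))"
proof -
  obtain t where t: "t \<in> templates k A" "realisations A t \<subseteq> Q" "Ent k A t = ex_ent k A Q"
    using ex_ent_attained[OF A Q] by blast
  have finQ: "finite Q" using Q(2) finite_colourings[OF A] by (rule finite_subset)
  have "real k powr ex_ent k A Q = real (card (realisations A t))"
    using card_realisations[OF A k t(1)] t(3) by simp
  also have "\<dots> \<le> real (card Q)" using t(2) finQ by (simp add: card_mono)
  finally have le: "real k powr ex_ent k A Q \<le> real (card Q)" .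
  have "card Q > 0" using Q finQ by (simp add: card_gt_0_iff)
  then show ?thesis using le k by (simp add: le_log_iff)
qed

lemma eventually_good_ssee_card:
  assumes "good_ssee V E"
  shows "eventually (\<lambda>n. card (V n) > m) sequentially"
proof -
  have "filterlim (\<lambda>n. real (card (V n))) at_top sequentially"
    using assms by (simp add: good_ssee_def)
  then have "eventually (\<lambda>n. real (card (V n)) > real m) sequentially"
    unfolding filterlim_at_top_dense by blast
  then show ?thesis by simp
qed

text \<open>\<open>lim\<close> is meaningful only once convergence is known. Monotonicity relates
  nonempty levels only, so it is used beyond an index after which all are nonempty; nonnegativity
  bounds the sequence from below.\<close>

lemma entropy_density_tendsto:
  assumes good: "good_ssee V E" and Q: "\<And>n. Q n \<noteq> {}" "\<And>n. Q n \<subseteq> colourings k (V n)"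
    and mono: "\<And>m n. m \<le> n \<Longrightarrow> V m \<noteq> {} \<Longrightarrow> V n \<noteq> {} \<Longrightarrow>
        ex_ent k (V n) (Q n) / real (card (V n)) \<le> ex_ent k (V m) (Q m) / real (card (V m))"
  shows "(\<lambda>n. ex_ent k (V n) (Q n) / real (card (V n))) \<longlonglongrightarrow> entropy_density V k Q"
proof -
  let ?a = "\<lambda>n. ex_ent k (V n) (Q n) / real (card (V n))"
  have finV: "finite (V m)" for m using good by (simp add: good_ssee_def ssee_def)
  have "eventually (\<lambda>n. V n \<noteq> {}) sequentially"
    using eventually_good_ssee_card[OF good, of 0] by eventually_elim auto
  then obtain n0 where n0: "\<And>n. n \<ge> n0 \<Longrightarrow> V n \<noteq> {}"
    by (auto simp: eventually_sequentially)
  have "0 \<le> ?a n" for n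
    by (rule ex_ent_attained[OF finV Q(1,2), of n]) simp
  moreover have "decseq (\<lambda>n. ?a (n + n0))"
    unfolding decseq_def using mono n0 by simp
  ultimately obtain L where "(\<lambda>n. ?a (n + n0)) \<longlonglongrightarrow> L"
    using decseq_convergent[of "\<lambda>n. ?a (n + n0)" 0] by blast
  then have "?a \<longlonglongrightarrow> L" by (rule LIMSEQ_offset)
  moreover from this have "lim ?a = L" by (rule limI)
  ultimately show ?thesis by (simp add: entropy_density_def)
qed

text \<open>
  Identities need not be embeddings, so \<open>Forb V E k N F\<close> at level \<open>N\<close> may be larger than
  \<open>P N\<close>. Replacing that level by \<open>P N\<close> keeps the property hereditary, and monotonicity then
  bounds the density of \<open>Forb V E k N F\<close> by the extremal entropy of \<open>P N\<close>.
\<close>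

lemma hereditary_Forb_truncation:
  assumes P: "hereditary_property V E k P" and F: "F = colourings k (V N) - P N"
    and H: "hereditary_property V E k (Forb V E k N F)" and S: "ssee V E"
  shows "hereditary_property V E k
    (\<lambda>m. if m < N then colourings k (V m) else if m = N then P N else Forb V E k N F m)"
    (is "hereditary_property V E k ?Q")
  unfolding hereditary_property_def
proof (intro conjI allI impI ballI)
  have Pcol: "P m \<subseteq> colourings k (V m)" for m using P by (simp add: hereditary_property_def)
  show Qcol: "?Q m \<subseteq> colourings k (V m)" for m using Pcol[of N] by (auto simp: Forb_def)
  fix m n c \<phi> assume mn: "m \<le> n" and c: "c \<in> ?Q n" and \<phi>: "\<phi> \<in> E m n"
  have "c \<in> V n \<rightarrow>\<^sub>E {1..k}" using c Qcol[of n] by (auto simp: colourings_def)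
  moreover have "\<phi> \<in> V m \<rightarrow>\<^sub>E V n" using S mn \<phi> by (auto simp: ssee_def)
  ultimately have col: "compose (V m) c \<phi> \<in> colourings k (V m)"
    by (auto simp: colourings_def compose_def)
  consider "m < N" | "m = N" "n = N" | "m = N" "n > N" | "m > N" using mn by linarith
  then show "compose (V m) c \<phi> \<in> ?Q m"
  proof cases
    case 1 then show ?thesis using col by simp
  next
    case 2
    then have "c \<in> P N" "\<phi> \<in> E N N" using c \<phi> by simp_all
    then have "compose (V N) c \<phi> \<in> P N" using P unfolding hereditary_property_def by blast
    then show ?thesis using 2 by simp
  next
    case 3
    then have "compose (V N) c \<phi> \<notin> F" using c \<phi> by (auto simp: Forb_def)
    then show ?thesis using col 3 by (simp add: F)
  next
    case 4
    then have "c \<in> Forb V E k N F n" using c mn by simp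
    then have "compose (V m) c \<phi> \<in> Forb V E k N F m"
      using H \<phi> mn unfolding hereditary_property_def by blast
    then show ?thesis using 4 by simp
  qed
qed

section \<open>Counting hereditary properties\<close>

theorem theorem3p21:
  fixes V :: "nat \<Rightarrow> 'a set"
    and E :: "nat \<Rightarrow> nat \<Rightarrow> ('a \<Rightarrow> 'a) set"
    and k :: nat
  assumes good: "good_ssee V E"
    and a: "\<And>P m n. hereditary_property V E k P \<Longrightarrow> (\<forall>n. P n \<noteq> {}) \<Longrightarrow>
        m \<le> n \<Longrightarrow> V m \<noteq> {} \<Longrightarrow> V n \<noteq> {} \<Longrightarrow>
        ex_ent k (V n) (P n) / real (card (V n)) \<le> ex_ent k (V m) (P m) / real (card (V m))"
    and forb_hereditary: "\<And>N F. F \<subseteq> colourings k (V N) \<Longrightarrow> F \<noteq> {} \<Longrightarrow>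
        (\<forall>n. Forb V E k N F n \<noteq> {}) \<Longrightarrow> hereditary_property V E k (Forb V E k N F)"
    and b: "\<And>N F \<epsilon>. F \<subseteq> colourings k (V N) \<Longrightarrow> F \<noteq> {} \<Longrightarrow>
        (\<forall>n. Forb V E k N F n \<noteq> {}) \<Longrightarrow> (\<epsilon>::real) > 0 \<Longrightarrow>
        \<exists>\<delta>>0::real. \<exists>n0. \<forall>n\<ge>n0. \<forall>t \<in> templates k (V n).
          real (card {(\<phi>, c). \<phi> \<in> E N n \<and> c \<in> F \<and> c \<in> realisations (V N) (compose (V N) t \<phi>)})
              \<le> \<delta> * real (card (E N n)) \<longrightarrow>
          Ent k (V n) t \<le> (entropy_density V k (Forb V E k N F) + \<epsilon>) * real (card (V n))"
  shows "\<forall>P. hereditary_property V E k P \<longrightarrow> (\<forall>n. P n \<noteq> {}) \<longrightarrow>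
           (\<exists>e :: nat \<Rightarrow> real. e \<longlonglongrightarrow> 0 \<and>
              (\<forall>n. real (card (P n)) = real k powr ((entropy_density V k P + e n) * real (card (V n)))))"
proof (intro allI impI)
  fix P assume P: "hereditary_property V E k P" and ne: "\<forall>n. P n \<noteq> {}"
  have S: "ssee V E" using good by (simp add: good_ssee_def)
  have finV: "finite (V m)" for m using S by (simp add: ssee_def)
  have Pcol: "P m \<subseteq> colourings k (V m)" for m using P by (simp add: hereditary_property_def)
  have finP: "finite (P m)" for m using Pcol finite_colourings[OF finV] by (rule finite_subset)
  have cP: "card (P m) > 0" for m using finP ne by (simp add: card_gt_0_iff)
  have Pcard: "card (P m) \<le> k ^ card (V m)" for m
    using card_mono[OF finite_colourings[OF finV] Pcol, of m] finV by (simp add: colourings_def card_PiE)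
  have nonempty: "eventually (\<lambda>n. V n \<noteq> {}) sequentially"
    using eventually_good_ssee_card[OF good, of 0] by eventually_elim auto
  show "\<exists>e :: nat \<Rightarrow> real. e \<longlonglongrightarrow> 0 \<and>
      (\<forall>n. real (card (P n)) = real k powr ((entropy_density V k P + e n) * real (card (V n))))"
  \<comment> \<open>Logarithms to base \<open>k\<close> degenerate for k < 2. There k = 0 is
    excluded by a nonempty \<open>P n\<close> over a nonempty \<open>V n\<close>, and for k = 1 both
    sides equal 1.\<close>
  proof (cases "k \<ge> 2")
    case False
    have "k \<noteq> 0"
    proof
      assume "k = 0"
      obtain n where "V n \<noteq> {}" using eventually_happens[OF nonempty] by auto
      then show False using Pcard[of n] cP[of n] \<open>k = 0\<close> finV[of n] by (simp add: power_0_left)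
    qed
    then have k: "k = 1" using False by simp
    have "card (P n) = 1" for n using Pcard[of n] cP[of n] k by simp
    then show ?thesis using k by (intro exI[of _ "\<lambda>_. 0"]) simp
  next
    case k: True
    let ?\<pi> = "entropy_density V k P"
    let ?a = "\<lambda>n. ex_ent k (V n) (P n) / real (card (V n))"
    have lim: "?a \<longlonglongrightarrow> ?\<pi>"
      using a[OF P ne] ne Pcol by (intro entropy_density_tendsto[OF good]) auto
    have upper: "eventually (\<lambda>n. real (card (P n)) \<le> real k powr ((?\<pi> + \<epsilon>) * real (card (V n)))) sequentially"
      if \<epsilon>: "\<epsilon> > 0" for \<epsilon>
    proof -
      \<comment> \<open>\<epsilon> is split in three: the choice of \<open>N\<close>,
        supersaturation, and the number of templates. Goodness speaks only about levels with more
        than one element.\<close>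
      have "eventually (\<lambda>n. ?a n < ?\<pi> + \<epsilon> / 3 \<and> card (V n) > 1) sequentially"
        using \<epsilon> by (intro eventually_conj order_tendstoD(2)[OF lim] eventually_good_ssee_card[OF good]) simp
      then obtain N where N: "?a N < ?\<pi> + \<epsilon> / 3" "card (V N) > 1"
        using eventually_happens by fastforce
      have VN: "V N \<noteq> {}" using N(2) by auto
      define F where "F = colourings k (V N) - P N"
      show ?thesis
      proof (cases "F = {}")
        \<comment> \<open>Supersaturation is given only for nonempty families. Here the full
          template is admissible at level \<open>N\<close>, so \<open>?a N\<close> is at least 1 and
          the trivial bound k^|V n| suffices.\<close>
        case True
        let ?t = "\<lambda>x\<in>V N. {1..k}"
        have "?t \<in> templates k (V N)" using k by (auto simp: templates_def)
        moreover have "realisations (V N) ?t \<subseteq> P N"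
        proof -
          have "realisations (V N) ?t = colourings k (V N)"
            unfolding realisations_def colourings_def by (rule PiE_cong) simp
          then show ?thesis using True by (simp add: F_def)
        qed
        ultimately have "Ent k (V N) ?t \<le> ex_ent k (V N) (P N)" by (rule Ent_le_ex_ent[OF finV])
        then have "real (card (V N)) \<le> ex_ent k (V N) (P N)" using k by (simp add: Ent_def)
        then have "1 \<le> ?a N" using N(2) by simp
        then have \<pi>1: "1 \<le> ?\<pi> + \<epsilon>" using N(1) \<epsilon> by linarith
        have "real (card (P n)) \<le> real k powr ((?\<pi> + \<epsilon>) * real (card (V n)))" for n
        proof -
          have "real (card (P n)) \<le> real (k ^ card (V n))" using Pcard by (simp only: of_nat_le_iff)
          also have "\<dots> = real k powr (1 * real (card (V n)))" using k by (simp add: powr_realpow)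
          also have "\<dots> \<le> real k powr ((?\<pi> + \<epsilon>) * real (card (V n)))"
            using k \<pi>1 by (intro powr_mono mult_right_mono) auto
          finally show ?thesis .
        qed
        then show ?thesis by simp
      next
        case False
        have FN: "F \<subseteq> colourings k (V N)" by (auto simp: F_def)
        have PF: "P n \<subseteq> Forb V E k N F n" for n
          using P by (auto simp: Forb_def F_def hereditary_property_def)
        have neF: "\<forall>n. Forb V E k N F n \<noteq> {}" using PF ne by fastforce
        note H = forb_hereditary[OF FN False neF]
        let ?\<pi>F = "entropy_density V k (Forb V E k N F)"
        have limF: "(\<lambda>n. ex_ent k (V n) (Forb V E k N F n) / real (card (V n))) \<longlonglongrightarrow> ?\<pi>F"
          using a[OF H neF] neF by (intro entropy_density_tendsto[OF good]) (auto simp: Forb_def)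
        let ?Q = "\<lambda>m. if m < N then colourings k (V m) else if m = N then P N else Forb V E k N F m"
        have Q: "hereditary_property V E k ?Q"
          by (rule hereditary_Forb_truncation[OF P F_def H S])
        have neQ: "\<forall>m. ?Q m \<noteq> {}" using ne neF Pcol by (metis subset_empty)
        have "eventually (\<lambda>n. ex_ent k (V n) (Forb V E k N F n) / real (card (V n)) \<le> ?a N) sequentially"
          using nonempty eventually_gt_at_top[of N]
        proof eventually_elim
          case (elim n)
          then show ?case using a[OF Q neQ, of N n] VN by simp
        qed
        then have \<pi>F: "?\<pi>F \<le> ?a N" by (intro tendsto_upperbound[OF limF]) auto
        obtain \<delta> n0 where \<delta>: "\<delta> > 0" and n0: "\<And>n t. n \<ge> n0 \<Longrightarrow> t \<in> templates k (V n) \<Longrightarrow>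
          real (card {(\<phi>, c). \<phi> \<in> E N n \<and> c \<in> F \<and> c \<in> realisations (V N) (compose (V N) t \<phi>)})
              \<le> \<delta> * real (card (E N n)) \<Longrightarrow>
          Ent k (V n) t \<le> (?\<pi>F + \<epsilon> / 3) * real (card (V n))"
          using b[OF FN False neF, of "\<epsilon> / 3"] \<epsilon> by auto
        have "\<epsilon> / 3 > 0" using \<epsilon> by simp
        from Forb_containers[OF good N(2) k FN this \<delta>] eventually_ge_at_top[of n0]
        show ?thesis
        proof eventually_elim
          case (elim n)
          define M where "M = real (card (V n))"
          obtain \<T> where \<T>: "finite \<T>" "real (card \<T>) \<le> real k powr (\<epsilon> / 3 * M)"
            "\<T> \<subseteq> templates k (V n)"
            "\<forall>t\<in>\<T>. real (card {(\<phi>, c). \<phi> \<in> E N n \<and> c \<in> F \<and> c \<in> realisations (V N) (compose (V N) t \<phi>)})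
              \<le> \<delta> * real (card (E N n))"
            "Forb V E k N F n \<subseteq> (\<Union>t\<in>\<T>. realisations (V n) t)"
            using elim(1) unfolding M_def by (elim exE conjE)
          have t: "real (card (realisations (V n) t)) \<le> real k powr ((?\<pi> + 2 * \<epsilon> / 3) * M)"
            if "t \<in> \<T>" for t
          proof -
            have "Ent k (V n) t \<le> (?\<pi>F + \<epsilon> / 3) * M"
              unfolding M_def using that \<T>(3,4) elim(2) by (intro n0) auto
            also have "\<dots> \<le> (?\<pi> + 2 * \<epsilon> / 3) * M"
              using \<pi>F N(1) by (intro mult_right_mono) (auto simp: M_def)
            finally show ?thesis
              using card_realisations[OF finV k, of t n] that \<T>(3) k by (auto intro: powr_mono)
          qed
          have fin: "finite (realisations (V n) t)" if "t \<in> \<T>" for t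
            using \<T>(3) that finV
            by (blast intro: finite_subset[OF realisations_subset_colourings finite_colourings])
          have "card (P n) \<le> card (\<Union>t\<in>\<T>. realisations (V n) t)"
            using \<T>(1,5) PF[of n] fin by (intro card_mono) auto
          also have "\<dots> \<le> (\<Sum>t\<in>\<T>. card (realisations (V n) t))" by (rule card_UN_le[OF \<T>(1)])
          also have "real \<dots> \<le> real (card \<T>) * real k powr ((?\<pi> + 2 * \<epsilon> / 3) * M)"
            unfolding of_nat_sum using t by (rule sum_bounded_above)
          also have "\<dots> \<le> real k powr (\<epsilon> / 3 * M) * real k powr ((?\<pi> + 2 * \<epsilon> / 3) * M)"
            using \<T>(2) by (intro mult_right_mono) auto
          also have "\<dots> = real k powr ((?\<pi> + \<epsilon>) * M)"
            by (simp add: powr_add[symmetric] algebra_simps)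
          finally show ?case by (simp add: M_def)
        qed
      qed
    qed
    \<comment> \<open>Obtained by solving the desired equation for the error. Where
      \<open>V n\<close> is empty the exponent is 0 for any value, and \<open>P n\<close> has
      exactly one element.\<close>
    define e where "e n = (if V n = {} then 0
      else log (real k) (real (card (P n))) / real (card (V n)) - ?\<pi>)" for n
    have "e \<longlonglongrightarrow> 0"
    proof (rule order_tendstoI)
      fix y :: real assume y: "y < 0"
      have "eventually (\<lambda>n. ?\<pi> + y < ?a n) sequentially"
        using y by (intro order_tendstoD(1)[OF lim]) simp
      with nonempty show "eventually (\<lambda>n. y < e n) sequentially"
      proof eventually_elim
        case (elim n)
        have "?a n \<le> log (real k) (real (card (P n))) / real (card (V n))"
          using ex_ent_le_log_card[OF finV _ Pcol k] ne by (intro divide_right_mono) auto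
        then show ?case using elim by (simp add: e_def)
      qed
    next
      fix y :: real assume y: "y > 0"
      have "eventually (\<lambda>n. real (card (P n)) \<le> real k powr ((?\<pi> + y / 2) * real (card (V n)))) sequentially"
        using y by (intro upper) simp
      with nonempty show "eventually (\<lambda>n. e n < y) sequentially"
      proof eventually_elim
        case (elim n)
        have M: "real (card (V n)) > 0" using elim(1) finV by (simp add: card_gt_0_iff)
        have "log (real k) (real (card (P n))) \<le> (?\<pi> + y / 2) * real (card (V n))"
          using elim(2) cP[of n] k by (simp add: log_le_iff)
        then have "log (real k) (real (card (P n))) / real (card (V n)) \<le> ?\<pi> + y / 2"
          using M by (simp add: pos_divide_le_eq)
        then show ?case using elim(1) y by (simp add: e_def)
      qed
    qed
    moreover have "real (card (P n)) = real k powr ((?\<pi> + e n) * real (card (V n)))" for n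
    proof (cases "V n = {}")
      case True
      then have "card (P n) = 1" using Pcard[of n] cP[of n] by simp
      then show ?thesis using True k by simp
    next
      case False
      then show ?thesis using cP[of n] k finV[of n] by (simp add: e_def)
    qed
    ultimately show ?thesis by blast
  qed
qed

end
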